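(* The characteristic polynomial of the Seidel matrix corresponding to a maximum affine equiangular set (with norm $3$ with respect to the switching root $\rho$) in $L$ is either $$(x+5)^{39}(x-13)^8(x-9)^8(x^2-19x+72)$$ or $$(x+5)^{39}(x-13)^6(x-9)^6(x-11)(x-12)(x^2-20x+87)^2.$$
   Context: Lattices. $A_n=\{x\in\mathbb{Z}^{n+1}: x_1+\cdots+x_{n+1}=0\}$ and $\alpha_n=(\frac1{n+1},\dots,\frac1{n+1},-\frac n{n+1})\in\mathbb{R}^{n+1}$ (so $\alpha_1=(\frac12,-\frac12)$). Let $\Lambda=A_5^3\oplus A_1^4\subset\mathbb{R}^{26}$; vectors of $\mathbb{R}^{26}$ are row vectors written $(v_1,\dots,v_7)$ with $v_1,v_2,v_3\in\mathbb{R}^6$ and $v_4,\dots,v_7\in\mathbb{R}^2$. Let $\beta_0=(\alpha_5,\alpha_5,\alpha_5,0,0,0,\alpha_1)$, $\beta_1=(3\alpha_5,0,0,0,\alpha_1,\alpha_1,\alpha_1)$, $\beta_2=(0,3\alpha_5,0,\alpha_1,0,\alpha_1,\alpha_1)$, $\beta_3=(0,0,3\alpha_5,\alpha_1,\alpha_1,0,\alpha_1)$. $L$ is the lattice generated by $\Lambda$ and $\beta_0,\beta_1,\beta_2,\beta_3$ (an integral lattice). Let $\rho=(0,0,0,0,0,0,2\alpha_1)$. Affine equiangular sets. A set $\omega$ of vectors is an affine equiangular set with norm $3$ with respect to the switching root $\rho$ if $(u,\rho)=1$ and $(u,u)=3$ for all $u\in\omega$, and $(u,v)\in\{0,1\}$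 for all distinct $u,v\in\omega$, where $(\cdot,\cdot)$ is the standard inner product. It is in $L$ if $\omega\subset L$, and it is maximum in $L$ if no such set in $L$ has larger cardinality. Seidel matrix. For an affine equiangular set $\omega=\{u_1,\dots,u_n\}$ with norm $3$ with respect to $\rho$, put $\widetilde{u}=(2u-\rho)/\sqrt2$ for $u\in\omega$; then $(\widetilde{u_i},\widetilde{u_i})=5$ and $(\widetilde{u_i},\widetilde{u_j})=\pm1$ for $i\ne j$. The Seidel matrix corresponding to $\omega$ is the $n\times n$ matrix $B^\top B-5I$, where $B=[\widetilde{u_1}^\top\ \widetilde{u_2}^\top\ \cdots\ \widetilde{u_n}^\top]$. *)

theory Defs
  imports
    Complex_Main
    "HOL-Library.Equipollence"
    "HOL-Algebra.Generated_Groups"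
    "Jordan_Normal_Form.Char_Poly"
begin

text \<open>Vectors are indexed from 0, so the coordinate written \<open>x\<^sub>i\<close> on paper is \<open>x $ (i - 1)\<close>.\<close>

definition A_lattice :: "nat \<Rightarrow> real vec set" where
  "A_lattice n =
    {x \<in> carrier_vec (n + 1). (\<forall>i < n + 1. x $ i \<in> \<int>) \<and> (\<Sum>i < n + 1. x $ i) = 0}"

definition alpha :: "nat \<Rightarrow> real vec" where
  "alpha n = vec (n + 1) (\<lambda>i. if i < n then 1 / real (n + 1) else - (real n / real (n + 1)))"

definition blocks ::
  "real vec \<Rightarrow> real vec \<Rightarrow> real vec \<Rightarrow> real vec \<Rightarrow> real vec \<Rightarrow> real vec \<Rightarrow> real vec \<Rightarrow> real vec" where
  "blocks v1 v2 v3 v4 v5 v6 v7 =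
    v1 @\<^sub>v v2 @\<^sub>v v3 @\<^sub>v v4 @\<^sub>v v5 @\<^sub>v v6 @\<^sub>v v7"

definition Lambda :: "real vec set" where
  "Lambda = {blocks v1 v2 v3 v4 v5 v6 v7 | v1 v2 v3 v4 v5 v6 v7.
     v1 \<in> A_lattice 5 \<and> v2 \<in> A_lattice 5 \<and> v3 \<in> A_lattice 5 \<and>
     v4 \<in> A_lattice 1 \<and> v5 \<in> A_lattice 1 \<and> v6 \<in> A_lattice 1 \<and> v7 \<in> A_lattice 1}"

definition beta0 :: "real vec" where
  "beta0 = blocks (alpha 5) (alpha 5) (alpha 5) (0\<^sub>v 2) (0\<^sub>v 2) (0\<^sub>v 2) (alpha 1)"

definition beta1 :: "real vec" where
  "beta1 = blocks (3 \<cdot>\<^sub>v alpha 5) (0\<^sub>v 6) (0\<^sub>v 6) (0\<^sub>v 2) (alpha 1) (alpha 1) (alpha 1)"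

definition beta2 :: "real vec" where
  "beta2 = blocks (0\<^sub>v 6) (3 \<cdot>\<^sub>v alpha 5) (0\<^sub>v 6) (alpha 1) (0\<^sub>v 2) (alpha 1) (alpha 1)"

definition beta3 :: "real vec" where
  "beta3 = blocks (0\<^sub>v 6) (0\<^sub>v 6) (3 \<cdot>\<^sub>v alpha 5) (alpha 1) (alpha 1) (0\<^sub>v 2) (alpha 1)"

text \<open>\<^const>\<open>monoid_vec\<close> is the additive group of vectors of a fixed dimension, so
  \<^const>\<open>generate\<close> yields the additive subgroup (the set of integral combinations).\<close>

definition L :: "real vec set" where
  "L = generate (monoid_vec TYPE(real) 26) (Lambda \<union> {beta0, beta1, beta2, beta3})"

definition rho :: "real vec" where
  "rho = blocks (0\<^sub>v 6) (0\<^sub>v 6) (0\<^sub>v 6) (0\<^sub>v 2) (0\<^sub>v 2) (0\<^sub>v 2) (2 \<cdot>\<^sub>v alpha 1)"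

definition affine_equiangular :: "real vec \<Rightarrow> real vec set \<Rightarrow> bool" where
  "affine_equiangular r \<omega> \<longleftrightarrow>
     \<omega> \<subseteq> carrier_vec (dim_vec r) \<and>
     (\<forall>u \<in> \<omega>. u \<bullet> r = 1 \<and> u \<bullet> u = 3) \<and>
     (\<forall>u \<in> \<omega>. \<forall>v \<in> \<omega>. u \<noteq> v \<longrightarrow> u \<bullet> v \<in> {0, 1})"

definition maximum_affine_equiangular_in ::
  "real vec set \<Rightarrow> real vec \<Rightarrow> real vec set \<Rightarrow> bool" where
  "maximum_affine_equiangular_in M r \<omega> \<longleftrightarrow>
     affine_equiangular r \<omega> \<and> \<omega> \<subseteq> M \<and>
     \<not> (\<exists>\<omega>'. affine_equiangular r \<omega>' \<and> \<omega>' \<subseteq> M \<and> \<omega> \<prec> \<omega>')"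

definition tilde :: "real vec \<Rightarrow> real vec \<Rightarrow> real vec" where
  "tilde r u = (1 / sqrt 2) \<cdot>\<^sub>v (2 \<cdot>\<^sub>v u - r)"

text \<open>The set enters as a list \<open>us\<close>, whose order is that of the rows and columns.\<close>

definition seidel_matrix :: "real vec \<Rightarrow> real vec list \<Rightarrow> real mat" where
  "seidel_matrix r us =
     (let B = mat_of_cols (dim_vec r) (map (tilde r) us)
      in B\<^sup>T * B - 5 \<cdot>\<^sub>m 1\<^sub>m (length us))"

end

theory Submission
  imports Defs
begin

text \<open>
  Put \<open>w = u - \<rho>/2\<close>, so that \<open>(w, w) = 5/2\<close> and \<open>(w, w') = \<plusminus>1/2\<close> for distinct vectors. Up to sign
  there are 336 candidates for \<open>w\<close>: 216 are indexed by triples in \<open>{0..5}\<^sup>3\<close>, and for each of the three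
  copies of \<open>A\<^sub>5\<close> there are 40 given by a sign vector in \<open>\<real>\<^sup>6\<close> with sum zero and a relative sign \<open>d\<close> of two
  \<open>A\<^sub>1\<close> components. Candidates of different kinds are always compatible. Triples must agree pairwise in at most one
  component, hence there are at most 36, with equality for Latin squares; in each of the other kinds there
  are at most 7, the positive supports forming a Pasch configuration for one value of \<open>d\<close> and a Pasch
  configuration without one of its blocks for the other.
  So the maximum is \<open>36 + 3 \<cdot> 7 = 57\<close>.

  The nonzero spectrum of the Gram matrix is that of the frame operator \<open>2 \<Sum> w w\<^sup>T\<close>. A Latin square
  contributes a multiple of the identity on \<open>A\<^sub>5\<^sup>3\<close>, whichever Latin square it is. Each family of 7
  determines a hexagon on the six points for which \<open>\<Sum> s s\<^sup>T\<close> is circulant, so after a Fourier transform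
  only the three alternating vectors remain coupled to the \<open>A\<^sub>1\<close> components. This block of
  size 6 depends only on the signs \<open>d\<close>, and its characteristic polynomial only on the product of
  the three signs.
\<close>

section \<open>Pasch configurations and sign vectors\<close>

text \<open>An executable enumeration: a claim about all families of sign vectors becomes a finite
  check.\<close>

fun cliques :: "('a \<Rightarrow> 'a \<Rightarrow> bool) \<Rightarrow> 'a list \<Rightarrow> 'a list list" where
  "cliques R [] = [[]]"
| "cliques R (x # xs) = (let cs = cliques R xs in map ((#) x) (filter (list_all (R x)) cs) @ cs)"

text \<open>Every set of pairwise related elements occurs, listed in the order of \<open>xs\<close>;
  hence a property checked on all \<open>cliques\<close> holds for arbitrary such sets.\<close>

lemma filter_in_cliques:
  assumes "\<And>x y. x \<in> F \<Longrightarrow> y \<in> F \<Longrightarrow> x \<noteq> y \<Longrightarrow> R x y" and "distinct xs"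
  shows "filter (\<lambda>x. x \<in> F) xs \<in> set (cliques R xs)"
  using assms(2)
proof (induction xs)
  case (Cons x xs)
  have "list_all (R x) (filter (\<lambda>x. x \<in> F) xs)" if "x \<in> F"
    using that assms(1)[of x] Cons.prems by (auto simp: list_all_iff)
  with Cons show ?case by (auto simp: Let_def)
qed simp

definition half_signs :: "int list list" where
  "half_signs = filter (\<lambda>s. sum_list s = 0) (List.n_lists 6 [1, -1])"

definition dot :: "int list \<Rightarrow> int list \<Rightarrow> int" where
  "dot s t = sum_list (map2 (*) s t)"

text \<open>For equal signs \<open>d\<close> the form of two signed codes is
  \<open>9 * p + 36\<close>, which is 18 or -18 exactly for \<open>p\<close> equal to -2 or -6. The
  value -6 means opposite vectors.\<close>

definition families :: "int list list list" where
  "families = cliques (\<lambda>s t. let p = dot s t in p = -6 \<or> p = -2) half_signs"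

text \<open>The Fourier basis of the vectors in \<open>\<real>\<^sup>6\<close> with coordinate sum zero, that is, the joint
  eigenvectors of the circulant matrices.\<close>

definition fourier :: "int list list" where
  "fourier = [[2, 1, -1, -2, -1, 1], [0, 1, 1, 0, -1, -1], [2, -1, -1, 2, -1, -1],
     [0, 1, -1, 0, 1, -1], [1, -1, 1, -1, 1, -1]]"

text \<open>\<open>h\<close> lists the six points in the cyclic order of a hexagon: position
  \<open>l\<close> of a Fourier vector belongs to the point \<open>h ! l\<close>.\<close>

definition fourier_transform :: "nat list \<Rightarrow> int list \<Rightarrow> int list" where
  "fourier_transform h s = (let t = map (\<lambda>i. s ! i) h in map (dot t) fourier)"

text \<open>\<open>A\<close> sums to zero, \<open>B\<close> sums to the alternating vector of the
  hexagon, and \<Sum> s s^T over both is diagonal in the Fourier basis. The diagonal entries are the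
  squared lengths 12, 4, 12, 4, 6 of the Fourier vectors times the eigenvalues 4, 4, 12, 12,
  10.\<close>

definition diagonalised_by :: "int list list \<Rightarrow> int list list \<Rightarrow> nat list \<Rightarrow> bool" where
  "diagonalised_by A B h \<longleftrightarrow> sort h = [0..<6] \<and>
    (let tA = map (fourier_transform h) A; tB = map (fourier_transform h) B in
      map (\<lambda>r. sum_list (map (\<lambda>t. t ! r) tA)) [0..<5] = [0, 0, 0, 0, 0] \<and>
      map (\<lambda>r. sum_list (map (\<lambda>t. t ! r) tB)) [0..<5] = [0, 0, 0, 0, 6] \<and>
      map (\<lambda>r. map (\<lambda>q. sum_list (map (\<lambda>t. t ! r * t ! q) (tA @ tB))) [0..<5]) [0..<5] =
        [[48, 0, 0, 0, 0], [0, 16, 0, 0, 0], [0, 0, 144, 0, 0], [0, 0, 0, 48, 0], [0, 0, 0, 0, 60]])"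

text \<open>If four sign vectors pairwise have inner product \<open>-2\<close>, their positive supports form a Pasch
  configuration, in which every point \<open>p\<close> lies in no common block with exactly one point,
  \<open>uncovered _ A p\<close>. Three compatible sign vectors are likewise a Pasch configuration with a block
  removed. The two fixed-point-free matchings obtained in this way form the hexagon below.\<close>

definition uncovered :: "nat list \<Rightarrow> int list list \<Rightarrow> nat \<Rightarrow> nat" where
  "uncovered xs A p = hd (filter (\<lambda>q. q \<noteq> p \<and> list_all (\<lambda>s. s ! p = -1 \<or> s ! q = -1) A) xs)"

text \<open>The four sign vectors of a Pasch configuration sum to zero, so \<open>col\<close>, the
  sum of \<open>B\<close>, is minus the missing vector: \<open>ms\<close> is the missing block and
  \<open>ps\<close> its complement. \<open>V\<close> goes from \<open>ps\<close> to
  \<open>ms\<close> along the matching of \<open>A\<close>, \<open>W\<close> goes back along that of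
  \<open>B\<close>.\<close>

definition hexagon :: "int list list \<Rightarrow> int list list \<Rightarrow> nat list" where
  "hexagon A B =
    (let col = (\<lambda>i. sum_list (map (\<lambda>s. s ! i) B));
         ps = filter (\<lambda>i. col i = 1) [0..<6];
         ms = filter (\<lambda>i. col i \<noteq> 1) [0..<6];
         V = uncovered ms A;
         W = (\<lambda>m. hd (filter (\<lambda>p. uncovered ms B p = m) ps));
         h0 = hd ps; h1 = V h0; h2 = W h1; h3 = V h2; h4 = W h3; h5 = V h4
     in [h0, h1, h2, h3, h4, h5])"

text \<open>For opposite signs \<open>d\<close> the form is \<open>9 * p\<close>, so the inner
  product must be 2 or -2.\<close>

definition compatible :: "int list list \<Rightarrow> int list list \<Rightarrow> bool" where
  "compatible A B \<longleftrightarrow> list_all (\<lambda>s. list_all (\<lambda>t. let p = dot s t in p = 2 \<or> p = -2) B) A"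

text \<open>Besides the diagonalisation this contains both size bounds: no family has more than four
  members, and one compatible with a family of four has at most three.\<close>

definition all_diagonalised :: "int list list list \<Rightarrow> bool" where
  "all_diagonalised fs \<longleftrightarrow>
    (let fs4 = filter (\<lambda>A. length A \<ge> 4) fs; fs3 = filter (\<lambda>A. length A \<ge> 3) fs in
      list_all (\<lambda>A. length A = 4 \<and>
        list_all (\<lambda>B. length B = 3 \<and> diagonalised_by A B (hexagon A B)) (filter (compatible A) fs3)) fs4)"

lemma all_diagonalised_families: "all_diagonalised families"
  by code_simp

section \<open>Determinants\<close>

lemma sum_lessThan_3: "(\<Sum>k<3. f k) = f 0 + f 1 + f (2 :: nat)"
  by (simp add: eval_nat_numeral)

lemma sum_lessThan_4: "(\<Sum>k<4. f k) = f 0 + f 1 + f 2 + f (3 :: nat)"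
  by (simp add: eval_nat_numeral)

text \<open>The Weinstein-Aronszajn identity. Multiplying the block matrix \<open>B\<close> by
  \<open>P\<close> clears its lower left block, multiplying it by \<open>Q\<close> the upper right
  one; the two values for its determinant are compared. The powers of \<open>z\<close> avoid a
  division.\<close>

lemma det_mult_swap:
  fixes X Z :: "real mat"
  assumes X: "X \<in> carrier_mat n m" and Z: "Z \<in> carrier_mat m n"
  shows "z ^ m * det (z \<cdot>\<^sub>m 1\<^sub>m n - X * Z) = z ^ n * det (z \<cdot>\<^sub>m 1\<^sub>m m - Z * X)"
proof -
  define B where "B = four_block_mat (1\<^sub>m m) Z X (z \<cdot>\<^sub>m 1\<^sub>m n)"
  define P where "P = four_block_mat (1\<^sub>m m) (0\<^sub>m m n) (- X) (1\<^sub>m n)"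
  define Q where "Q = four_block_mat (z \<cdot>\<^sub>m 1\<^sub>m m) (- Z) (0\<^sub>m n m) (1\<^sub>m n)"
  have [simp]: "dim_row X = n" "dim_col X = m" "dim_row Z = m" "dim_col Z = n"
    using X Z by auto
  have B: "B \<in> carrier_mat (m + n) (m + n)" and P: "P \<in> carrier_mat (m + n) (m + n)"
    and Q: "Q \<in> carrier_mat (m + n) (m + n)"
    by (auto simp: B_def P_def Q_def)
  have PB: "P * B = four_block_mat (1\<^sub>m m) Z (0\<^sub>m n m) (z \<cdot>\<^sub>m 1\<^sub>m n - X * Z)"
  proof -
    have "P * B = four_block_mat (1\<^sub>m m * 1\<^sub>m m + 0\<^sub>m m n * X) (1\<^sub>m m * Z + 0\<^sub>m m n * (z \<cdot>\<^sub>m 1\<^sub>m n))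
        (- X * 1\<^sub>m m + 1\<^sub>m n * X) (- X * Z + 1\<^sub>m n * (z \<cdot>\<^sub>m 1\<^sub>m n))"
      unfolding P_def B_def by (rule mult_four_block_mat[of _ m m _ n _ n _ _ m _ n]) (use X Z in simp_all)
    also have "- X * 1\<^sub>m m + 1\<^sub>m n * X = 0\<^sub>m n m"
      using X by (intro eq_matI) auto
    also have "- X * Z + 1\<^sub>m n * (z \<cdot>\<^sub>m 1\<^sub>m n) = z \<cdot>\<^sub>m 1\<^sub>m n - X * Z"
      using X Z by (intro eq_matI) auto
    finally show ?thesis using X Z by simp
  qed
  have QB: "Q * B = four_block_mat (z \<cdot>\<^sub>m 1\<^sub>m m - Z * X) (0\<^sub>m m n) X (z \<cdot>\<^sub>m 1\<^sub>m n)"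
  proof -
    have "Q * B = four_block_mat ((z \<cdot>\<^sub>m 1\<^sub>m m) * 1\<^sub>m m + - Z * X) ((z \<cdot>\<^sub>m 1\<^sub>m m) * Z + - Z * (z \<cdot>\<^sub>m 1\<^sub>m n))
        (0\<^sub>m n m * 1\<^sub>m m + 1\<^sub>m n * X) (0\<^sub>m n m * Z + 1\<^sub>m n * (z \<cdot>\<^sub>m 1\<^sub>m n))"
      unfolding Q_def B_def by (rule mult_four_block_mat[of _ m m _ n _ n _ _ m _ n]) (use X Z in simp_all)
    also have "(z \<cdot>\<^sub>m 1\<^sub>m m) * Z + - Z * (z \<cdot>\<^sub>m 1\<^sub>m n) = 0\<^sub>m m n"
      using Z by (intro eq_matI) (auto simp: mult_smult_distrib[of _ m n _ n])
    also have "(z \<cdot>\<^sub>m 1\<^sub>m m) * 1\<^sub>m m + - Z * X = z \<cdot>\<^sub>m 1\<^sub>m m - Z * X"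
      using X Z by (intro eq_matI) auto
    finally show ?thesis using X Z by simp
  qed
  have Zn: "z \<cdot>\<^sub>m 1\<^sub>m n - X * Z \<in> carrier_mat n n" and Zm: "z \<cdot>\<^sub>m 1\<^sub>m m - Z * X \<in> carrier_mat m m"
    by (simp_all add: carrier_matI)
  have "det P = 1"
    unfolding P_def by (subst det_four_block_mat_upper_right_zero[of _ m _ n]) (use X in auto)
  moreover have "det Q = z ^ m"
    unfolding Q_def by (subst det_four_block_mat_lower_left_zero[of _ m _ n]) (use Z in auto)
  moreover have "det (P * B) = det (z \<cdot>\<^sub>m 1\<^sub>m n - X * Z)"
    unfolding PB using det_four_block_mat_lower_left_zero[OF one_carrier_mat Z refl Zn] by simp
  moreover have "det (Q * B) = det (z \<cdot>\<^sub>m 1\<^sub>m m - Z * X) * z ^ n"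
    unfolding QB using det_four_block_mat_upper_right_zero[OF Zm refl X, of "z \<cdot>\<^sub>m 1\<^sub>m n"] by simp
  ultimately show ?thesis
    using det_mult[OF P B] det_mult[OF Q B] by (simp add: mult.commute)
qed

lemma det_3:
  fixes A :: "'a :: comm_ring_1 mat"
  assumes "A \<in> carrier_mat 3 3"
  shows "det A =
    A $$ (0,0) * (A $$ (1,1) * A $$ (2,2) - A $$ (1,2) * A $$ (2,1))
    - A $$ (0,1) * (A $$ (1,0) * A $$ (2,2) - A $$ (1,2) * A $$ (2,0))
    + A $$ (0,2) * (A $$ (1,0) * A $$ (2,1) - A $$ (1,1) * A $$ (2,0))"
proof -
  have *: "det B = B $$ (0,0) * B $$ (1,1) - B $$ (0,1) * B $$ (1,0)" if "B \<in> carrier_mat 2 2" for B :: "'a mat"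
    using that by (subst laplace_expansion_row[OF that, of 0])
      (auto simp: numeral_2_eq_2 cofactor_def det_single mat_delete_def)
  show ?thesis
    using assms by (subst laplace_expansion_row[OF assms, of 0])
      (auto simp: numeral_3_eq_3 cofactor_def * mat_delete_def numeral_2_eq_2 algebra_simps)
qed

text \<open>In the Fourier coordinates the frame operator is diagonal apart from a block of size six,
  which couples the three coordinates from \<open>A\<^sub>1\<close> (rows 12 to 14) with the three alternating vectors
  (rows 15 to 17).\<close>

definition coupling :: "(nat \<Rightarrow> int) \<Rightarrow> nat \<Rightarrow> nat \<Rightarrow> int" where
  "coupling d p q = (if p = q then 0 else if q = (p + 1) mod 3 then 1 else - d p)"

text \<open>The matrix is not symmetric because each row carries its weight: the coupling 18 is
  multiplied by 1 in rows 12 to 14 and by 1/108 in rows 15 to 17. For distinct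
  \<open>p, q < 3\<close> the number \<open>3 - p - q\<close> is the third index.\<close>

definition frame_entry :: "(nat \<Rightarrow> int) \<Rightarrow> nat \<Rightarrow> nat \<Rightarrow> real" where
  "frame_entry d i j =
    (if i < 12 then (if i = j then (if i mod 4 < 2 then 14 else 18) else 0)
     else if j < 12 then 0
     else if i < 15 then
       (if j < 15 then (if i = j then 14 else of_int (d (3 - (i - 12) - (j - 12))))
        else 18 * of_int (coupling d (j - 15) (i - 12)))
     else
       (if j < 15 then of_int (coupling d (i - 15) (j - 12)) / 6
        else if i = j then 17 else 0))"

text \<open>A diagonal part of size 12 splits off. In the remaining part of size 6 the lower right
  block is scalar, so its determinant reduces to one of size 3.\<close>

lemma det_frame:
  fixes z :: real
  assumes "d 0 \<in> {1, -1}" "d 1 \<in> {1, -1}" "d 2 \<in> {1, -1}"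
  defines "a \<equiv> z\<^sup>2 - 31 * z + 232" and "b \<equiv> z - 20"
  shows "det (z \<cdot>\<^sub>m 1\<^sub>m 18 - mat 18 18 (\<lambda>(i, j). frame_entry d i j)) =
    (z - 14) ^ 6 * (z - 18) ^ 6 * (a ^ 3 - 3 * a * b\<^sup>2 - 2 * of_int (d 0 * d 1 * d 2) * b ^ 3)"
proof -
  define D where "D = mat 12 12 (\<lambda>(i, j). if i = j then z - (if i mod 4 < 2 then 14 else 18) else 0)"
  define T where "T = mat 3 3 (\<lambda>(i, j). if i = j then z - 14 else - of_int (d (3 - i - j)))"
  define E where "E = mat 3 3 (\<lambda>(i, j). - (18 * of_int (coupling d j i) :: real))"
  define E' where "E' = mat 3 3 (\<lambda>(i, j). - (of_int (coupling d i j) / 6 :: real))"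
  define S where "S = (z - 17) \<cdot>\<^sub>m 1\<^sub>m 3"
  have E': "E' \<in> carrier_mat 3 3" by (simp add: E'_def)
  have "z \<cdot>\<^sub>m 1\<^sub>m 18 - mat 18 18 (\<lambda>(i, j). frame_entry d i j) =
      four_block_mat D (0\<^sub>m 12 6) (0\<^sub>m 6 12) (four_block_mat T E E' S)" (is "?M = ?F")
  proof (rule eq_matI)
    fix i j assume "i < dim_row ?F" "j < dim_col ?F"
    then have "i < 18" "j < 18" by (auto simp: D_def S_def T_def)
    have cases: "k < 12 \<or> (\<exists>p<3. k = 12 + p) \<or> (\<exists>p<3. k = 15 + p)" if "k < 18" for k :: nat
      using that by presburger
    from cases[OF \<open>i < 18\<close>] cases[OF \<open>j < 18\<close>] show "?M $$ (i, j) = ?F $$ (i, j)"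
      by (elim disjE exE conjE; simp add: D_def S_def E_def E'_def T_def frame_entry_def)
  qed (auto simp: D_def S_def T_def)
  also have "det ?F = det D * det (four_block_mat T E E' S)"
    by (rule det_four_block_mat_lower_left_zero[of _ 12 _ 6]) (auto simp: D_def S_def T_def)
  also have "det D = (\<Prod>i<(12::nat). z - (if i mod 4 < 2 then 14 else 18))"
    by (subst det_upper_triangular[of _ 12])
      (simp_all add: D_def prod_list_diag_prod atLeast0LessThan upper_triangular_def)
  also have "{..<12 :: nat} = {0, 1, 4, 5, 8, 9} \<union> {2, 3, 6, 7, 10, 11}"
    by (auto; presburger)
  also have "(\<Prod>i\<in>\<dots>. z - (if i mod 4 < 2 then 14 else 18)) = (z - 14) ^ 6 * (z - 18) ^ 6"
    by (subst prod.union_disjoint) (simp_all add: power_numeral_even power_numeral_odd Let_def mult.assoc)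
  \<comment> \<open>Valid because the scalar matrix \<open>S\<close> commutes with
    \<open>E'\<close>.\<close>
  also have "det (four_block_mat T E E' S) = det (T * S - E * E')"
  proof (rule det_four_block_mat)
    show "E' * S = S * E'"
      using E' by (simp add: S_def mult_smult_distrib[of _ 3 3 _ 3] mult_smult_assoc_mat[of _ 3 3 _ 3])
  qed (auto simp: T_def S_def E_def E'_def)
  \<comment> \<open>The product \<open>E * E'\<close> has diagonal entries 6, and off the diagonal
    -3 times the sign of the third index. Hence \<open>a = (z - 14) * (z - 17) - 6\<close> and
    \<open>b = (z - 17) - 3\<close>.\<close>
  also have "T * S - E * E' = mat 3 3 (\<lambda>(i, j). if i = j then a else - of_int (d (3 - i - j)) * b)"
    (is "?L = ?R")
  proof (rule eq_matI)
    fix i j assume "i < dim_row ?R" "j < dim_col ?R"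
    then have ij: "i < 3" "j < 3" by auto
    have L: "?L $$ (i, j) = (z - 17) * T $$ (i, j) - (\<Sum>k<3. E $$ (i, k) * E' $$ (k, j))"
      using ij by (simp add: S_def T_def E_def E'_def scalar_prod_def atLeast0LessThan
          mult_smult_distrib[of _ 3 3 _ 3])
    have squares: "of_int (d k) * of_int (d k) = (1 :: real)" if "k \<in> {0, 1, 2}" for k
      using that assms(1-3) by auto
    have "i \<in> {0, 1, 2}" "j \<in> {0, 1, 2}" using ij by auto
    then show "?L $$ (i, j) = ?R $$ (i, j)"
      unfolding L using squares
      by (elim insertE emptyE; simp add: T_def E_def E'_def coupling_def sum_lessThan_3 a_def b_def power2_eq_square algebra_simps)
  qed (auto simp: S_def T_def E_def E'_def)
  also have "det \<dots> = a ^ 3 - a * b\<^sup>2 * ((of_int (d 0))\<^sup>2 + (of_int (d 1))\<^sup>2 + (of_int (d 2))\<^sup>2)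
      - 2 * of_int (d 0 * d 1 * d 2) * b ^ 3"
    by (subst det_3) (simp_all add: power2_eq_square power3_eq_cube algebra_simps)
  also have "\<dots> = a ^ 3 - 3 * a * b\<^sup>2 - 2 * of_int (d 0 * d 1 * d 2) * b ^ 3"
    using assms(1-3) by auto
  finally show ?thesis by simp
qed

text \<open>By \<open>det_mult_swap\<close> the determinant of size 57 becomes \<open>z ^ 39\<close>
  times the one of size 18, where 39 = 57 - 18 and the shift by 5 is
  \<open>z = x + 5\<close>.\<close>

lemma char_poly_of_frame:
  assumes X: "X \<in> carrier_mat 57 18" and Z: "Z \<in> carrier_mat 18 57"
    and ZX: "Z * X = mat 18 18 (\<lambda>(i, j). frame_entry d i j)"
    and d: "d 0 \<in> {1, -1}" "d 1 \<in> {1, -1}" "d 2 \<in> {1, -1}"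
  shows "char_poly (X * Z - 5 \<cdot>\<^sub>m 1\<^sub>m 57) =
           [:5, 1:] ^ 39 * [:-13, 1:] ^ 8 * [:-9, 1:] ^ 8 * [:72, -19, 1:]
       \<or> char_poly (X * Z - 5 \<cdot>\<^sub>m 1\<^sub>m 57) =
           [:5, 1:] ^ 39 * [:-13, 1:] ^ 6 * [:-9, 1:] ^ 6 * [:-11, 1:] * [:-12, 1:]
             * [:87, -20, 1:] ^ 2"
proof -
  define S where "S = X * Z - 5 \<cdot>\<^sub>m 1\<^sub>m 57"
  have S: "S \<in> carrier_mat 57 57" using X Z by (auto simp: S_def)
  define q where "q z = (z - 14) ^ 6 * (z - 18) ^ 6 *
    ((z\<^sup>2 - 31 * z + 232) ^ 3 - 3 * (z\<^sup>2 - 31 * z + 232) * (z - 20)\<^sup>2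
      - 2 * of_int (d 0 * d 1 * d 2) * (z - 20) ^ 3)" for z :: real
  \<comment> \<open>The exception is \<open>z = 0\<close>, where \<open>z ^ 18\<close> cannot be
    cancelled.\<close>
  have poly_S: "poly (char_poly S) x = (x + 5) ^ 39 * q (x + 5)" if "x \<noteq> -5" for x
  proof -
    define z where "z = x + 5"
    have "- char_matrix S x = z \<cdot>\<^sub>m 1\<^sub>m 57 - X * Z"
      using X Z S by (intro eq_matI) (auto simp: char_matrix_def S_def z_def)
    then have "z ^ 18 * poly (char_poly S) x = z ^ 57 * q z"
      using det_mult_swap[OF X Z, of z] det_frame[of d z, OF d]
      by (simp add: char_poly_matrix[OF S] ZX q_def)
    also have "\<dots> = z ^ 18 * (z ^ 39 * q z)" by (simp flip: power_add mult.assoc)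
    finally have "poly (char_poly S) x = z ^ 39 * q z"
      by (subst (asm) mult_left_cancel) (use that in \<open>auto simp: z_def\<close>)
    then show ?thesis by (simp only: z_def)
  qed
  \<comment> \<open>Two polynomials that agree at all points but one are equal.\<close>
  have eqI: "char_poly S = p" if "\<And>x. poly p x = (x + 5) ^ 39 * q (x + 5)" for p
  proof (rule ccontr)
    assume "char_poly S \<noteq> p"
    then have "finite {x. poly (char_poly S - p) x = 0}" by (intro poly_roots_finite) simp
    moreover have "UNIV - {-5} \<subseteq> {x. poly (char_poly S - p) x = 0}" using that poly_S by auto
    ultimately show False
      using infinite_UNIV_char_0 finite_subset by (metis finite.emptyI finite.insertI finite_Diff2)
  qed
  have "d 0 * d 1 * d 2 \<in> {1, -1}" using d by auto
  then consider "d 0 * d 1 * d 2 = -1" | "d 0 * d 1 * d 2 = 1" by blast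
  then show ?thesis
  proof cases
    case 1
    have "poly ([:5, 1:] ^ 39 * [:-13, 1:] ^ 8 * [:-9, 1:] ^ 8 * [:72, -19, 1:]) x
        = (x + 5) ^ 39 * q (x + 5)" for x
    proof -
      \<comment> \<open>With \<open>a\<close> and \<open>b\<close> as in \<open>det_frame\<close>,
        this is \<open>a ^ 3 - 3 * a * b\<^sup>2 + 2 * b ^ 3 = (a - b)\<^sup>2 * (a + 2 *
        b)\<close>.\<close>
      have "((x + 5)\<^sup>2 - 31 * (x + 5) + 232) ^ 3
          - 3 * ((x + 5)\<^sup>2 - 31 * (x + 5) + 232) * (x - 15)\<^sup>2 + 2 * (x - 15) ^ 3
          = ((x - 13) * (x - 9))\<^sup>2 * (x * (x - 19) + 72)"
        by (simp add: power2_eq_square power3_eq_cube algebra_simps)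
      then have eq: "(x - 13) ^ 8 * (x - 9) ^ 8 * (x * (x - 19) + 72) = q (x + 5)"
        unfolding q_def 1 by (simp add: power_mult_distrib eval_nat_numeral)
      show ?thesis unfolding eq[symmetric] by (simp add: algebra_simps)
    qed
    then show ?thesis by (intro disjI1 eqI[unfolded S_def])
  next
    case 2
    have "poly ([:5, 1:] ^ 39 * [:-13, 1:] ^ 6 * [:-9, 1:] ^ 6 * [:-11, 1:] * [:-12, 1:]
             * [:87, -20, 1:] ^ 2) x = (x + 5) ^ 39 * q (x + 5)" for x
    proof -
      \<comment> \<open>Here the factorisation is \<open>(a + b)\<^sup>2 * (a - 2 * b)\<close>, and
        \<open>a - 2 * b\<close> splits further.\<close>
      have "((x + 5)\<^sup>2 - 31 * (x + 5) + 232) ^ 3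
          - 3 * ((x + 5)\<^sup>2 - 31 * (x + 5) + 232) * (x - 15)\<^sup>2 - 2 * (x - 15) ^ 3
          = (x - 11) * (x - 12) * (x * (x - 20) + 87)\<^sup>2"
        by (simp add: power2_eq_square power3_eq_cube algebra_simps)
      then have eq: "(x - 13) ^ 6 * (x - 9) ^ 6 * (x - 11) * (x - 12) * (x * (x - 20) + 87)\<^sup>2 = q (x + 5)"
        unfolding q_def 2 by (simp add: power_mult_distrib eval_nat_numeral)
      show ?thesis unfolding eq[symmetric] by (simp add: algebra_simps)
    qed
    then show ?thesis by (intro disjI2 eqI[unfolded S_def])
  qed
qed

section \<open>Fourier coordinates of sign vectors\<close>

lemma sum_lessThan_6: "(\<Sum>k<6. f k) = f 0 + f 1 + f 2 + f 3 + f 4 + f (5 :: nat)"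
  by (simp add: eval_nat_numeral)

lemma set_half_signs:
  "set half_signs = {s. length s = 6 \<and> set s \<subseteq> {1, -1} \<and> sum_list s = 0}"
  by (auto simp: half_signs_def set_n_lists)

lemma distinct_half_signs: "distinct half_signs"
  unfolding half_signs_def by (rule distinct_filter, rule distinct_n_lists) simp

lemma half_signs_nth: "s \<in> set half_signs \<Longrightarrow> i < 6 \<Longrightarrow> s ! i = 1 \<or> s ! i = -1"
  using nth_mem[of i s] by (auto simp: set_half_signs subset_iff)

lemma sum_half_signs: "s \<in> set half_signs \<Longrightarrow> (\<Sum>i<6. s ! i) = 0"
  by (auto simp: set_half_signs sum_list_sum_nth atLeast0LessThan)

lemma dot_eq_sum: "length s = length t \<Longrightarrow> dot s t = (\<Sum>i<length s. s ! i * t ! i)"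
  by (simp add: dot_def sum_list_sum_nth atLeast0LessThan)

lemma dot_half_signs:
  "s \<in> set half_signs \<Longrightarrow> t \<in> set half_signs \<Longrightarrow> dot s t = (\<Sum>i<6. s ! i * t ! i)"
  by (subst dot_eq_sum) (auto simp: set_half_signs)

definition coefficient :: "nat list \<Rightarrow> nat \<Rightarrow> (nat \<Rightarrow> int) \<Rightarrow> int" where
  "coefficient h r f = (\<Sum>l<6. fourier ! r ! l * f (h ! l))"

lemma fourier_transform_nth:
  assumes "length h = 6" "r < 5"
  shows "fourier_transform h s ! r = coefficient h r ((!) s)"
proof -
  have "length fourier = 5" and "length (fourier ! r) = 6"
    using \<open>r < 5\<close> by (auto simp: fourier_def less_Suc_eq eval_nat_numeral)
  then show ?thesis using assms
    by (simp add: fourier_transform_def coefficient_def Let_def dot_def sum_list_sum_nth atLeast0LessThan mult.commute)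
qed

text \<open>The squared lengths of the Fourier vectors. All of them divide 12, so the division in
  \<open>parseval\<close> is exact.\<close>

definition fourier_norm :: "nat \<Rightarrow> int" where
  "fourier_norm r = [12, 4, 12, 4, 6] ! r"

lemma bij_betw_nth_labelling:
  assumes "sort h = [0..<6]"
  shows "length h = 6" "bij_betw ((!) h) {..<6} {..<6}"
proof -
  show len: "length h = 6" using arg_cong[OF assms, of length] by simp
  have "distinct h" "set h = {..<6}"
    using arg_cong[OF assms, of distinct] arg_cong[OF assms, of set] by (auto simp: atLeast0LessThan)
  then show "bij_betw ((!) h) {..<6} {..<6}"
    using len by (metis bij_betw_nth)
qed

lemma fourier_orthogonal:
  assumes "r < 5" "q < 5"
  shows "(\<Sum>l<6. fourier ! r ! l * fourier ! q ! l) = (if r = q then fourier_norm r else 0)"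
  using assms unfolding sum_lessThan_6
  by (auto simp: fourier_def fourier_norm_def less_Suc_eq eval_nat_numeral)

lemma sum_fourier: "r < 5 \<Longrightarrow> (\<Sum>l<6. fourier ! r ! l) = 0"
  unfolding sum_lessThan_6 by (auto simp: fourier_def less_Suc_eq eval_nat_numeral)

text \<open>The five Fourier vectors are an orthogonal basis of the vectors with sum zero; it
  suffices that \<open>f\<close> is one of these, as the constant part of \<open>g\<close> is then
  orthogonal to \<open>f\<close>. The factor 12 keeps everything integral.\<close>

lemma parseval:
  assumes h: "sort h = [0..<6]" and f: "(\<Sum>l<6. f l) = 0"
  shows "12 * (\<Sum>l<6. f l * g l) =
    (\<Sum>r<5. (12 div fourier_norm r) * coefficient h r f * coefficient h r g)"
proof -
  have reindex: "(\<Sum>l<6. k l) = (\<Sum>l<6. k (h ! l))" for k :: "nat \<Rightarrow> int"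
    using sum.reindex_bij_betw[OF bij_betw_nth_labelling(2)[OF h], of k] by simp
  have "(\<Sum>l<6. f (h ! l)) = 0" using f reindex[of f] by simp
  then have f0: "f (h ! 0) = - f (h ! 1) - f (h ! 2) - f (h ! 3) - f (h ! 4) - f (h ! 5)"
    unfolding sum_lessThan_6 by linarith
  show ?thesis
    unfolding reindex[of "\<lambda>l. f l * g l"] coefficient_def sum_lessThan_6 f0
    by (simp add: fourier_def fourier_norm_def eval_nat_numeral algebra_simps)
qed

text \<open>The values \<open>4, 4, 12, 12, 10\<close> are the eigenvalues of \<open>\<Sum>\<^bsub>s\<^esub> s s\<^sup>T\<close> on the Fourier basis.\<close>

lemma diagonalised_byD:
  assumes "diagonalised_by A B h"
  shows "sort h = [0..<6]"
    and "r < 5 \<Longrightarrow> (\<Sum>s\<leftarrow>A. coefficient h r ((!) s)) = 0"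
    and "r < 5 \<Longrightarrow> (\<Sum>s\<leftarrow>B. coefficient h r ((!) s)) = (if r = 4 then 6 else 0)"
    and "r < 5 \<Longrightarrow> q < 5 \<Longrightarrow>
      (\<Sum>s\<leftarrow>A. coefficient h r ((!) s) * coefficient h q ((!) s))
      + (\<Sum>s\<leftarrow>B. coefficient h r ((!) s) * coefficient h q ((!) s))
      = (if r = q then fourier_norm r * [4, 4, 12, 12, 10] ! r else 0)"
proof -
  show h: "sort h = [0..<6]" using assms by (simp add: diagonalised_by_def)
  note ft = fourier_transform_nth[OF bij_betw_nth_labelling(1)[OF h]]
  have A: "map (\<lambda>r. \<Sum>s\<leftarrow>A. fourier_transform h s ! r) [0..<5] = [0, 0, 0, 0, 0]"
    and B: "map (\<lambda>r. \<Sum>s\<leftarrow>B. fourier_transform h s ! r) [0..<5] = [0, 0, 0, 0, 6]"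
    and AB: "map (\<lambda>r. map (\<lambda>q. \<Sum>s\<leftarrow>A @ B. fourier_transform h s ! r * fourier_transform h s ! q) [0..<5]) [0..<5] =
        [[48, 0, 0, 0, 0], [0, 16, 0, 0, 0], [0, 0, 144, 0, 0], [0, 0, 0, 48, 0], [0, 0, 0, 0, 60]]"
    using assms by (simp_all add: diagonalised_by_def Let_def comp_def)
  show "(\<Sum>s\<leftarrow>A. coefficient h r ((!) s)) = 0" if "r < 5"
    using that arg_cong[OF A, of "\<lambda>xs. xs ! r"] ft[of r]
    by (auto simp: less_Suc_eq eval_nat_numeral)
  show "(\<Sum>s\<leftarrow>B. coefficient h r ((!) s)) = (if r = 4 then 6 else 0)" if "r < 5"
    using that arg_cong[OF B, of "\<lambda>xs. xs ! r"] ft[of r]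
    by (auto simp: less_Suc_eq eval_nat_numeral)
  show "(\<Sum>s\<leftarrow>A. coefficient h r ((!) s) * coefficient h q ((!) s))
      + (\<Sum>s\<leftarrow>B. coefficient h r ((!) s) * coefficient h q ((!) s))
      = (if r = q then fourier_norm r * [4, 4, 12, 12, 10] ! r else 0)" if "r < 5" "q < 5"
    using that arg_cong[OF AB, of "\<lambda>xs. xs ! r ! q"] ft[of r] ft[of q]
    by (auto simp: less_Suc_eq eval_nat_numeral fourier_norm_def)
qed

section \<open>Consequences of the finite check for sets of sign vectors\<close>

lemma families_length_le: "A \<in> set families \<Longrightarrow> length A \<le> 4"
  using all_diagonalised_families by (auto simp: all_diagonalised_def Let_def list_all_iff)

lemma compatible_families_diagonalised:
  assumes "A \<in> set families" "B \<in> set families" "length A + length B \<ge> 7" "length A \<ge> 4"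
    and "\<And>s t. s \<in> set A \<Longrightarrow> t \<in> set B \<Longrightarrow> dot s t \<in> {2, -2}"
  shows "length A = 4" "length B = 3" "\<exists>h. diagonalised_by A B h"
proof -
  have "length A = 4" using families_length_le[OF assms(1)] assms(4) by simp
  moreover have "compatible A B" using assms(5) by (auto simp: compatible_def list_all_iff Let_def)
  ultimately have "length B = 3 \<and> diagonalised_by A B (hexagon A B)"
    using all_diagonalised_families assms(1-4)
    by (auto simp: all_diagonalised_def Let_def list_all_iff)
  then show "length B = 3" "\<exists>h. diagonalised_by A B h" by blast+
  show "length A = 4" by fact
qed

text \<open>Neither set has more than four elements, so seven in total force one of them to have
  four and the other at least three; the finite check applies to this pair.\<close>

lemma sign_families:
  fixes F :: "int \<Rightarrow> int list set"
  assumes F: "\<And>d. d \<in> {1, -1} \<Longrightarrow> F d \<subseteq> set half_signs"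
    and same: "\<And>d s t. d \<in> {1, -1} \<Longrightarrow> s \<in> F d \<Longrightarrow> t \<in> F d \<Longrightarrow> s \<noteq> t \<Longrightarrow> dot s t \<in> {-6, -2}"
    and cross: "\<And>d s t. d \<in> {1, -1} \<Longrightarrow> s \<in> F d \<Longrightarrow> t \<in> F (- d) \<Longrightarrow> dot s t \<in> {2, -2}"
    and card: "card (F 1) + card (F (-1)) \<ge> 7"
  obtains d A B h where "d \<in> {1, -1}" "F d = set A" "F (- d) = set B" "distinct A" "distinct B"
    "length A = 4" "length B = 3" "diagonalised_by A B h"
proof -
  define l where "l d = filter (\<lambda>s. s \<in> F d) half_signs" for d
  have l: "l d \<in> set families" "set (l d) = F d" "distinct (l d)" "length (l d) = card (F d)"
    if "d \<in> {1, -1}" for d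
  proof -
    show "l d \<in> set families" unfolding l_def families_def Let_def
      by (rule filter_in_cliques[OF _ distinct_half_signs]) (use same[OF that] in blast)
    show "set (l d) = F d" "distinct (l d)" 
      using F[OF that] distinct_half_signs by (auto simp: l_def)
    then show "length (l d) = card (F d)" by (metis distinct_card)
  qed
  have "length (l 1) + length (l (-1)) \<ge> 7" using l card by simp
  moreover have "length (l 1) \<le> 4" "length (l (-1)) \<le> 4" using families_length_le[OF l(1)] by simp_all
  ultimately obtain d where d: "d \<in> {1, -1}" and len: "length (l d) \<ge> 4" "length (l d) + length (l (- d)) \<ge> 7"
    by (cases "length (l 1) \<ge> 4") (force, fastforce)
  have d': "- d \<in> {1, -1}" using d by auto
  note * = compatible_families_diagonalised[OF l(1)[OF d] l(1)[OF d'] len(2,1)]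
  have "dot s t \<in> {2, -2}" if "s \<in> set (l d)" "t \<in> set (l (- d))" for s t
    using that cross[OF d] l(2)[OF d] l(2)[OF d'] by simp
  with * obtain h where "length (l d) = 4" "length (l (- d)) = 3" "diagonalised_by (l d) (l (- d)) h"
    by blast
  then show ?thesis using that d l[OF d] l[OF d'] by metis
qed

section \<open>Equiangular sets in coordinates\<close>

text \<open>Up to sign, the vectors \<open>u - \<rho>/2\<close> for \<open>u \<in> L\<close> of norm 3 with \<open>(u, \<rho>) = 1\<close> come in
  two kinds: \<open>Triple i j k\<close> has the entries \<open>1/6\<close> in the \<open>A\<^sub>5\<close> blocks except for \<open>-5/6\<close> at
  the positions \<open>i, j, k\<close>, and \<open>Signed b d s\<close> is \<open>s/2\<close> in the \<open>b\<close>-th \<open>A\<^sub>5\<close> block and has the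
  components \<open>0, \<alpha>\<^sub>1, d \<alpha>\<^sub>1\<close> in the \<open>A\<^sub>1\<close> blocks \<open>b, b + 1, b + 2\<close> modulo 3.
  The coordinates are scaled to integers: by 6 in the \<open>A\<^sub>5\<close> blocks, and as multiples of
  \<open>\<alpha>\<^sub>1\<close> in the \<open>A\<^sub>1\<close> blocks.\<close>

datatype code = Triple nat nat nat | Signed nat int "int list"

definition codes :: "code set" where
  "codes = {Triple i j k | i j k. i < 6 \<and> j < 6 \<and> k < 6}
    \<union> {Signed b d s | b d s. b < 3 \<and> d \<in> {1, -1} \<and> s \<in> set half_signs}"

fun component :: "nat \<Rightarrow> code \<Rightarrow> nat" where
  "component b (Triple i j k) = [i, j, k] ! b"
| "component b (Signed b' d s) = b'"

fun ycoord :: "code \<Rightarrow> nat \<Rightarrow> nat \<Rightarrow> int" where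
  "ycoord (Triple i j k) b l = (if l = [i, j, k] ! b then -5 else 1)"
| "ycoord (Signed b' d s) b l = (if b = b' then 3 * s ! l else 0)"

fun ncoord :: "code \<Rightarrow> nat \<Rightarrow> int" where
  "ncoord (Triple i j k) b = 0"
| "ncoord (Signed b' d s) b = (if b = b' then 0 else if b = (b' + 1) mod 3 then 1 else d)"

text \<open>36 times the inner product of the candidates: the coordinates in \<open>A_5\<close> are
  scaled by 6, and \<alpha>_1 has norm 1/2. Thus inner products 1/2 and -1/2 become 18 and
  -18.\<close>

definition form :: "code \<Rightarrow> code \<Rightarrow> int" where
  "form c c' = (\<Sum>b<3. (\<Sum>l<6. ycoord c b l * ycoord c' b l) + 18 * (ncoord c b * ncoord c' b))"

definition equiangular_codes :: "code set \<Rightarrow> bool" where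
  "equiangular_codes C \<longleftrightarrow>
    C \<subseteq> codes \<and> (\<forall>c \<in> C. \<forall>c' \<in> C. c \<noteq> c' \<longrightarrow> form c c' \<in> {18, -18})"

definition triples :: "code set" where
  "triples = {Triple i j k | i j k. i < 6 \<and> j < 6 \<and> k < 6}"

definition signeds :: "nat \<Rightarrow> code set" where
  "signeds b = {Signed b d s | d s. d \<in> {1, -1} \<and> s \<in> set half_signs}"

lemma codes_eq: "codes = triples \<union> (\<Union>b<3. signeds b)"
  by (auto simp: codes_def triples_def signeds_def)

lemma less_3_cases: "b < 3 \<Longrightarrow> b = 0 \<or> b = 1 \<or> b = (2 :: nat)"
  by linarith

lemma less_5_cases: "r < 5 \<Longrightarrow> r = 0 \<or> r = 1 \<or> r = 2 \<or> r = 3 \<or> r = (4 :: nat)"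
  by linarith

lemma component_triples: "c \<in> triples \<Longrightarrow> b < 3 \<Longrightarrow> component b c < 6"
  by (auto simp: triples_def dest!: less_3_cases)

lemma ycoord_triples: "c \<in> triples \<Longrightarrow> ycoord c b = (\<lambda>l. if l = component b c then -5 else 1)"
  by (auto simp: triples_def)

lemma ncoord_triples: "c \<in> triples \<Longrightarrow> ncoord c b = 0"
  by (auto simp: triples_def)

section \<open>Inner products and the Latin square of the triples\<close>

lemma sum_one_minus_six:
  fixes p q :: nat
  assumes "p < 6" "q < 6"
  shows "(\<Sum>l<6. (if l = p then -5 else 1) * (if l = q then -5 else 1 :: int)) = (if p = q then 30 else -6)"
proof -
  have "(\<Sum>l<6. (if l = p then -5 else 1) * (if l = q then -5 else 1 :: int))
    = (\<Sum>l<6. 1 - (if l = p then 6 else 0) - (if l = q then 6 else 0) + (if l = p then if p = q then 36 else 0 else 0))"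
    by (intro sum.cong) auto
  also have "\<dots> = (if p = q then 30 else -6)"
    using assms by (simp add: sum.distrib sum_subtractf)
  finally show ?thesis .
qed

text \<open>A block contributes 30 if the components agree and -6 otherwise. So the values 18 and
  -18 mean agreement in one component and in none.\<close>

lemma form_triples:
  assumes "c \<in> triples" "c' \<in> triples"
  shows "form c c' = (\<Sum>b<3. if component b c = component b c' then 36 else 0) - 18"
proof -
  have "form c c' = (\<Sum>b<3. if component b c = component b c' then 30 else -6)"
    unfolding form_def using assms
    by (intro sum.cong) (auto simp: ycoord_triples ncoord_triples component_triples
        sum_one_minus_six[OF component_triples component_triples])
  then show ?thesis by (simp add: sum_lessThan_3)
qed

lemma form_signeds:
  assumes "b < 3" "s \<in> set half_signs" "t \<in> set half_signs"
  shows "form (Signed b d s) (Signed b d' t) = 9 * dot s t + 18 * (1 + d * d')"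
proof -
  have "(\<Sum>l<6. (3 * s ! l) * (3 * t ! l)) = 9 * dot s t"
    using assms by (simp add: dot_half_signs sum_distrib_left algebra_simps)
  moreover have "b \<in> {0, 1, 2}" using assms(1) by auto
  ultimately show ?thesis
    by (elim insertE emptyE) (simp_all add: form_def sum_lessThan_3)
qed

lemma finite_triples: "finite triples"
proof -
  have "triples = (\<lambda>(i, j, k). Triple i j k) ` ({..<6} \<times> {..<6} \<times> {..<6})"
    by (auto simp: triples_def image_iff)
  then show ?thesis by (metis finite_imageI finite_cartesian_product finite_lessThan)
qed

lemma finite_signeds: "finite (signeds b)"
proof -
  have "signeds b = (\<lambda>(d, s). Signed b d s) ` ({1, -1} \<times> set half_signs)"
    by (auto simp: signeds_def image_iff)
  then show ?thesis by (metis finite_imageI finite_cartesian_product finite.intros finite_set)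
qed

context
  fixes C assumes C: "equiangular_codes C"
begin

text \<open>Agreement in two components would make the form at least 54.\<close>

lemma inj_on_components:
  assumes "b < 3" "b' < 3" "b \<noteq> b'"
  shows "inj_on (\<lambda>c. (component b c, component b' c)) (C \<inter> triples)"
proof (rule inj_onI, rule ccontr)
  fix c c' assume c: "c \<in> C \<inter> triples" "c' \<in> C \<inter> triples" "c \<noteq> c'"
    and eq: "(component b c, component b' c) = (component b c', component b' c')"
  have "form c c' \<in> {18, -18}" using C c by (auto simp: equiangular_codes_def)
  moreover have "(\<Sum>a\<in>{b, b'}. if component a c = component a c' then 36 else 0 :: int)
      \<le> (\<Sum>a<3. if component a c = component a c' then 36 else 0)"
    using assms by (intro sum_mono2) auto
  ultimately show False using eq assms c by (simp add: form_triples)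
qed

lemma card_triples_le: "card (C \<inter> triples) \<le> 36"
proof -
  have "card (C \<inter> triples) \<le> card ({..<6 :: nat} \<times> {..<6 :: nat})"
    by (rule card_inj_on_le[OF inj_on_components[of 0 1]]) (auto intro: component_triples)
  then show ?thesis by simp
qed

text \<open>In the case of equality the triples form a Latin square.\<close>

lemma bij_betw_components:
  assumes "card (C \<inter> triples) = 36" "b < 3" "b' < 3" "b \<noteq> b'"
  shows "bij_betw (\<lambda>c. (component b c, component b' c)) (C \<inter> triples) ({..<6} \<times> {..<6})"
proof -
  let ?f = "\<lambda>c. (component b c, component b' c)"
  have inj: "inj_on ?f (C \<inter> triples)" using inj_on_components assms by blast
  moreover have "?f ` (C \<inter> triples) = {..<6} \<times> {..<6}"
    by (rule card_subset_eq) (use assms in \<open>auto intro: component_triples simp: card_image[OF inj]\<close>)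
  ultimately show ?thesis by (simp add: bij_betw_def)
qed

text \<open>Two components of a Latin square run through all 36 pairs exactly once, so the sum
  factorises.\<close>

lemma sum_triples_different:
  fixes f g :: "nat \<Rightarrow> int"
  assumes "card (C \<inter> triples) = 36" "b < 3" "b' < 3" "b \<noteq> b'"
  shows "(\<Sum>c\<in>C \<inter> triples. f (component b c) * g (component b' c)) = (\<Sum>t<6. f t) * (\<Sum>t<6. g t)"
  using sum.reindex_bij_betw[OF bij_betw_components[OF assms], of "\<lambda>(p, q). f p * g q"]
  by (simp add: sum_product sum.cartesian_product)

lemma sum_triples_same:
  fixes f :: "nat \<Rightarrow> int"
  assumes "card (C \<inter> triples) = 36" "b < 3"
  shows "(\<Sum>c\<in>C \<inter> triples. f (component b c)) = 6 * (\<Sum>t<6. f t)"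
  using sum_triples_different[OF assms, of "if b = 0 then 1 else 0" f "\<lambda>_. 1"] assms(2) by auto

end

lemma coefficient_one_minus_six:
  assumes h: "sort h = [0..<6]" and "r < 5" "m < 6"
  shows "coefficient h r (\<lambda>l. if l = h ! m then -5 else 1) = -6 * fourier ! r ! m"
proof -
  have "coefficient h r (\<lambda>l. if l = h ! m then -5 else 1)
      = (\<Sum>l<6. fourier ! r ! l - (if l = m then 6 * fourier ! r ! l else 0))"
    unfolding coefficient_def
    using bij_betw_imp_inj_on[OF bij_betw_nth_labelling(2)[OF h]] \<open>m < 6\<close>
    by (intro sum.cong) (auto simp: inj_on_def)
  also have "\<dots> = -6 * fourier ! r ! m"
    using \<open>m < 6\<close> by (simp add: sum_subtractf sum_fourier[OF \<open>r < 5\<close>])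
  finally show ?thesis .
qed

text \<open>The entries -5 and 1 are those of the constant vector minus six times a unit vector, and
  the constant part is orthogonal to the Fourier basis. Hence these six vectors sum to zero and have
  frame operator 36 on the vectors of sum zero, whatever the hexagon.\<close>

lemma sum_coefficient_one_minus_six:
  assumes h: "sort h = [0..<6]" and "r < 5" "q < 5"
  defines "g \<equiv> \<lambda>r t. coefficient h r (\<lambda>l. if l = t then -5 else 1)"
  shows "(\<Sum>t<6. g r t) = 0" "(\<Sum>t<6. g r t * g q t) = (if r = q then 36 * fourier_norm r else 0)"
proof -
  have reindex: "(\<Sum>t<6. k t) = (\<Sum>m<6. k (h ! m))" for k :: "nat \<Rightarrow> int"
    using sum.reindex_bij_betw[OF bij_betw_nth_labelling(2)[OF h], of k] by simp
  have g: "g r (h ! m) = -6 * fourier ! r ! m" if "r < 5" "m < 6" for r m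
    using coefficient_one_minus_six[OF h that] by (simp add: g_def)
  have "(\<Sum>t<6. g r t) = -6 * (\<Sum>m<6. fourier ! r ! m)"
    unfolding reindex[of "g r"] sum_distrib_left by (intro sum.cong) (use g assms in auto)
  then show "(\<Sum>t<6. g r t) = 0" using sum_fourier[OF \<open>r < 5\<close>] by simp
  have "(\<Sum>t<6. g r t * g q t) = 36 * (\<Sum>m<6. fourier ! r ! m * fourier ! q ! m)"
    unfolding reindex[of "\<lambda>t. g r t * g q t"] sum_distrib_left by (intro sum.cong) (use g assms in auto)
  then show "(\<Sum>t<6. g r t * g q t) = (if r = q then 36 * fourier_norm r else 0)"
    using fourier_orthogonal[OF \<open>r < 5\<close> \<open>q < 5\<close>] by simp
qed

section \<open>The seven signed codes of one block\<close>

lemma coefficient_signed: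
  "coefficient h r (ycoord (Signed b d s) b') = (if b' = b then 3 * coefficient h r ((!) s) else 0)"
  by (simp add: coefficient_def sum_distrib_left algebra_simps)

text \<open>All second moments of the codes in one block. The numbers 36, 36, 108, 108, 90 are the
  eigenvalues 4, 4, 12, 12, 10 times 9, since a sign vector enters as \<open>3 * s\<close>.\<close>

definition block_structure :: "code set \<Rightarrow> nat \<Rightarrow> int \<Rightarrow> nat list \<Rightarrow> bool" where
  "block_structure C b d h \<longleftrightarrow> d \<in> {1, -1} \<and> sort h = [0..<6] \<and>
    (\<forall>r<5. \<forall>q<5. (\<Sum>c\<in>C \<inter> signeds b. coefficient h r (ycoord c b) * coefficient h q (ycoord c b))
      = (if r = q then fourier_norm r * [36, 36, 108, 108, 90] ! r else 0)) \<and>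
    (\<forall>r<5. \<forall>b'<3. (\<Sum>c\<in>C \<inter> signeds b. coefficient h r (ycoord c b) * ncoord c b')
      = (if r = 4 then 18 * coupling (\<lambda>_. d) b b' else 0)) \<and>
    (\<forall>p<3. \<forall>q<3. (\<Sum>c\<in>C \<inter> signeds b. ncoord c p * ncoord c q)
      = (if p = b \<or> q = b then 0 else if p = q then 7 else d))"

lemma signeds_structure:
  assumes C: "equiangular_codes C" and b: "b < 3" and card: "card (C \<inter> signeds b) \<ge> 7"
  shows "card (C \<inter> signeds b) = 7" "\<exists>d h. block_structure C b d h"
proof -
  define F where "F d = {s \<in> set half_signs. Signed b d s \<in> C}" for d
  have split: "C \<inter> signeds b = Signed b 1 ` F 1 \<union> Signed b (-1) ` F (-1)"
    by (auto simp: F_def signeds_def)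
  have fin: "finite (F d)" for d by (simp add: F_def)
  have inj: "inj_on (Signed b d) (F d)" for d by (simp add: inj_on_def)
  have cardF: "card (C \<inter> signeds b) = card (F 1) + card (F (-1))"
    unfolding split by (subst card_Un_disjoint) (auto simp: fin card_image[OF inj])
  have form: "9 * dot s t + 18 * (1 + d * d') \<in> {18, -18}"
    if "s \<in> F d" "t \<in> F d'" "d \<noteq> d' \<or> s \<noteq> t" for d d' s t
  proof -
    have "form (Signed b d s) (Signed b d' t) \<in> {18, -18}"
      using C that by (auto simp: equiangular_codes_def F_def)
    then show ?thesis using form_signeds[OF b] that by (auto simp: F_def)
  qed
  have same: "dot s t \<in> {-6, -2}" if "d \<in> {1, -1}" "s \<in> F d" "t \<in> F d" "s \<noteq> t" for d s t
    using form[OF that(2,3)] that(1,4) by auto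
  have cross: "dot s t \<in> {2, -2}" if "d \<in> {1, -1}" "s \<in> F d" "t \<in> F (- d)" for d s t
    using form[OF that(2,3)] that(1) by auto
  have sub: "F d \<subseteq> set half_signs" for d by (auto simp: F_def)
  have card7: "card (F 1) + card (F (-1)) \<ge> 7" using card cardF by simp
  obtain d A B h where d: "d \<in> {1, -1}" and FA: "F d = set A" and FB: "F (- d) = set B"
    and dist: "distinct A" "distinct B" and len: "length A = 4" "length B = 3"
    and h: "diagonalised_by A B h"
    by (rule sign_families[of F]) (rule sub, (rule same; assumption), (rule cross; assumption), rule card7, blast)
  have sum: "(\<Sum>c\<in>C \<inter> signeds b. f c) = (\<Sum>s\<leftarrow>A. f (Signed b d s)) + (\<Sum>s\<leftarrow>B. f (Signed b (- d) s))"
    for f :: "code \<Rightarrow> int"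
  proof -
    have "C \<inter> signeds b = Signed b d ` set A \<union> Signed b (- d) ` set B"
      using d FA FB split by auto
    moreover have "Signed b d ` set A \<inter> Signed b (- d) ` set B = {}" using d by auto
    ultimately show ?thesis
      by (simp add: sum.union_disjoint sum.reindex inj_on_def sum_list_distinct_conv_sum_set dist)
  qed
  note D = diagonalised_byD[OF h]
  have const: "(\<Sum>s\<leftarrow>xs. k) = int (length xs) * k" for xs :: "int list list" and k :: int
    by (simp add: sum_list_triv)
  show "card (C \<inter> signeds b) = 7"
    using d FA FB dist len cardF by (auto simp: distinct_card)
  have "block_structure C b d h"
    unfolding block_structure_def
  proof (intro conjI allI impI)
    show "d \<in> {1, -1}" by fact
    show "sort h = [0..<6]" using D(1) .
  next
    fix r q :: nat assume rq: "r < 5" "q < 5"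
    have "(\<Sum>c\<in>C \<inter> signeds b. coefficient h r (ycoord c b) * coefficient h q (ycoord c b))
      = 9 * ((\<Sum>s\<leftarrow>A. coefficient h r ((!) s) * coefficient h q ((!) s))
           + (\<Sum>s\<leftarrow>B. coefficient h r ((!) s) * coefficient h q ((!) s)))"
      unfolding sum coefficient_signed by (simp add: algebra_simps flip: sum_list_const_mult)
    also have "\<dots> = (if r = q then fourier_norm r * [36, 36, 108, 108, 90] ! r else 0)"
      unfolding D(4)[OF rq] using less_5_cases[OF rq(1)] by auto
    finally show "(\<Sum>c\<in>C \<inter> signeds b. coefficient h r (ycoord c b) * coefficient h q (ycoord c b))
      = (if r = q then fourier_norm r * [36, 36, 108, 108, 90] ! r else 0)" .
  next
    fix r b' :: nat assume r: "r < 5" "b' < 3"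
    \<comment> \<open>The \<open>A_1\<close> component as a function of the sign. Since
      \<open>A\<close> sums to zero, only the three codes with sign \<open>- d\<close> contribute
      below; hence the \<open>- d p\<close> in \<open>coupling\<close>.\<close>
    define n where "n d = (if b' = b then 0 else if b' = (b + 1) mod 3 then 1 else d :: int)" for d
    have "(\<Sum>c\<in>C \<inter> signeds b. coefficient h r (ycoord c b) * ncoord c b')
      = 3 * n d * (\<Sum>s\<leftarrow>A. coefficient h r ((!) s)) + 3 * n (- d) * (\<Sum>s\<leftarrow>B. coefficient h r ((!) s))"
      unfolding sum coefficient_signed ncoord.simps n_def[symmetric]
      by (simp add: ac_simps flip: sum_list_const_mult)
    then show "(\<Sum>c\<in>C \<inter> signeds b. coefficient h r (ycoord c b) * ncoord c b')
      = (if r = 4 then 18 * coupling (\<lambda>_. d) b b' else 0)"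
      using D(2,3)[OF r(1)] by (auto simp: n_def coupling_def)
  next
    \<comment> \<open>Four codes have sign \<open>d\<close> and three have \<open>- d\<close>:
      products of distinct components add up to \<open>4 * d - 3 * d = d\<close>, squares to
      7.\<close>
    fix p q :: nat assume "p < 3" "q < 3"
    from less_3_cases[OF this(1)] less_3_cases[OF this(2)] less_3_cases[OF b]
    show "(\<Sum>c\<in>C \<inter> signeds b. ncoord c p * ncoord c q)
      = (if p = b \<or> q = b then 0 else if p = q then 7 else d)"
      unfolding sum ncoord.simps const len using d
      by (elim disjE insertE emptyE; simp)
  qed
  then show "\<exists>d h. block_structure C b d h" by blast
qed

section \<open>Second moments of a maximum set of codes\<close>

lemma sum_codes:
  fixes f :: "code \<Rightarrow> 'a :: comm_monoid_add"
  assumes "C \<subseteq> codes"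
  shows "(\<Sum>c\<in>C. f c) = (\<Sum>c\<in>C \<inter> triples. f c) + (\<Sum>b<3. \<Sum>c\<in>C \<inter> signeds b. f c)"
proof -
  have "C = (C \<inter> triples) \<union> (\<Union>b<3. C \<inter> signeds b)"
    using assms by (auto simp: codes_eq)
  then have "(\<Sum>c\<in>C. f c) = (\<Sum>c\<in>(C \<inter> triples) \<union> (\<Union>b<3. C \<inter> signeds b). f c)" by simp
  also have "\<dots> = (\<Sum>c\<in>C \<inter> triples. f c) + (\<Sum>c\<in>(\<Union>b<3. C \<inter> signeds b). f c)"
    by (rule sum.union_disjoint) (auto simp: finite_triples finite_signeds, auto simp: triples_def signeds_def)
  also have "(\<Sum>c\<in>(\<Union>b<3. C \<inter> signeds b). f c) = (\<Sum>b<3. \<Sum>c\<in>C \<inter> signeds b. f c)"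
    by (rule sum.UNION_disjoint) (auto simp: finite_signeds, auto simp: signeds_def)
  finally show ?thesis .
qed

lemma card_codes:
  "C \<subseteq> codes \<Longrightarrow> card C = card (C \<inter> triples) + (\<Sum>b<3. card (C \<inter> signeds b))"
  using sum_codes[of C "\<lambda>_. 1 :: nat"] by simp

text \<open>All bounds in 36 + 7 + 7 + 7 are attained, so the contributions add up. The triples give
  216 on each \<open>A_5\<close>, which added to the values of \<open>block_structure\<close> yields
  252, 252, 324, 324, 306.\<close>

lemma equiangular_codes_structure:
  assumes C: "equiangular_codes C" and card: "card C \<ge> 57"
  obtains d hs where "card C = 57"
    "\<And>b. b < 3 \<Longrightarrow> d b \<in> {1, -1}" "\<And>b. b < 3 \<Longrightarrow> sort (hs b) = [0..<6]"
    "\<And>b b' r q. b < 3 \<Longrightarrow> b' < 3 \<Longrightarrow> r < 5 \<Longrightarrow> q < 5 \<Longrightarrow>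
      (\<Sum>c\<in>C. coefficient (hs b) r (ycoord c b) * coefficient (hs b') q (ycoord c b'))
      = (if b = b' \<and> r = q then fourier_norm r * [252, 252, 324, 324, 306] ! r else 0)"
    "\<And>b b' r. b < 3 \<Longrightarrow> b' < 3 \<Longrightarrow> r < 5 \<Longrightarrow>
      (\<Sum>c\<in>C. coefficient (hs b) r (ycoord c b) * ncoord c b')
      = (if r = 4 then 18 * coupling d b b' else 0)"
    "\<And>p q. p < 3 \<Longrightarrow> q < 3 \<Longrightarrow> (\<Sum>c\<in>C. ncoord c p * ncoord c q) = (if p = q then 14 else d (3 - p - q))"
proof -
  have sub: "C \<subseteq> codes" using C by (simp add: equiangular_codes_def)
  have le7: "card (C \<inter> signeds b) \<le> 7" if "b < 3" for b
    using signeds_structure(1)[OF C that] by linarith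
  have le: "card (C \<inter> triples) \<le> 36" by (rule card_triples_le[OF C])
  have cardC: "card C = card (C \<inter> triples) + card (C \<inter> signeds 0) + card (C \<inter> signeds 1) + card (C \<inter> signeds 2)"
    using card_codes[OF sub] by (simp add: sum_lessThan_3)
  have eq36: "card (C \<inter> triples) = 36" and eq7: "card (C \<inter> signeds b) = 7" if "b < 3" for b
    using cardC le le7[of 0] le7[of 1] le7[of 2] card less_3_cases[OF that] by auto
  have eq36: "card (C \<inter> triples) = 36" by (rule eq36[of 0]) simp
  have "\<exists>d h. block_structure C b d h" if "b < 3" for b
    using signeds_structure(2)[OF C that] eq7[OF that] by simp
  then obtain d hs where f: "\<And>b. b < 3 \<Longrightarrow> block_structure C b (d b) (hs b)" by metis
  have d: "d b \<in> {1, -1}" and hs: "sort (hs b) = [0..<6]"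
    and KK: "r < 5 \<Longrightarrow> q < 5 \<Longrightarrow>
      (\<Sum>c\<in>C \<inter> signeds b. coefficient (hs b) r (ycoord c b) * coefficient (hs b) q (ycoord c b))
      = (if r = q then fourier_norm r * [36, 36, 108, 108, 90] ! r else 0)"
    and Kn: "r < 5 \<Longrightarrow> b' < 3 \<Longrightarrow>
      (\<Sum>c\<in>C \<inter> signeds b. coefficient (hs b) r (ycoord c b) * ncoord c b')
      = (if r = 4 then 18 * coupling d b b' else 0)"
    and nn: "p < 3 \<Longrightarrow> q < 3 \<Longrightarrow> (\<Sum>c\<in>C \<inter> signeds b. ncoord c p * ncoord c q)
      = (if p = b \<or> q = b then 0 else if p = q then 7 else d b)" if "b < 3" for b b' r q p
    using f[OF that] by (simp_all add: block_structure_def coupling_def)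
  have zero: "coefficient h r (ycoord c b) = 0" if "c \<in> signeds b0" "b0 \<noteq> b" for c b b0 h r
    using that by (auto simp: signeds_def coefficient_signed)
  define g where "g b r t = coefficient (hs b) r (\<lambda>l. if l = t then -5 else 1)" for b r t
  have g: "(\<Sum>t<6. g b r t) = 0" "(\<Sum>t<6. g b r t * g b q t) = (if r = q then 36 * fourier_norm r else 0)"
    if "b < 3" "r < 5" "q < 5" for b r q
    using sum_coefficient_one_minus_six[OF hs that(2,3)] that(1) by (auto simp: g_def)
  have Kg: "coefficient (hs b) r (ycoord c b) = g b r (component b c)" if "c \<in> triples" for b r c
    using that by (simp add: ycoord_triples g_def)
  show ?thesis
  proof (rule that)
    show "card C = 57" using cardC eq36 eq7 by simp
    fix b b' r q :: nat assume b: "b < 3" "b' < 3" and r: "r < 5" "q < 5"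
    have "(\<Sum>c\<in>C \<inter> triples. coefficient (hs b) r (ycoord c b) * coefficient (hs b') q (ycoord c b'))
      = (\<Sum>c\<in>C \<inter> triples. g b r (component b c) * g b' q (component b' c))"
      by (intro sum.cong) (auto simp: Kg)
    \<comment> \<open>In a Latin square each component takes every value six times, giving 6 * 36 =
      216; for different blocks the sum is a product of two zero sums.\<close>
    also have "\<dots> = (if b = b' \<and> r = q then 216 * fourier_norm r else 0)"
    proof (cases "b = b'")
      case True
      then show ?thesis
        using sum_triples_same[OF C eq36 b(1), of "\<lambda>t. g b r t * g b q t"] g(2)[OF b(1) r] by simp
    next
      case False
      then show ?thesis
        using sum_triples_different[OF C eq36 b False, of "g b r" "g b' q"] g(1)[OF b(1) r] by simp
    qed
    moreover have "(\<Sum>c\<in>C \<inter> signeds b0. coefficient (hs b) r (ycoord c b) * coefficient (hs b') q (ycoord c b'))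
      = (if b0 = b then if b = b' \<and> r = q then fourier_norm r * [36, 36, 108, 108, 90] ! r else 0 else 0)"
      if "b0 < 3" for b0
      using KK[OF b(1) r] zero[of _ b0] by (cases "b0 = b"; cases "b0 = b'") auto
    ultimately show "(\<Sum>c\<in>C. coefficient (hs b) r (ycoord c b) * coefficient (hs b') q (ycoord c b'))
      = (if b = b' \<and> r = q then fourier_norm r * [252, 252, 324, 324, 306] ! r else 0)"
      using b less_5_cases[OF r(1)] by (auto simp: sum_codes[OF sub])
  next
    fix b b' r :: nat assume b: "b < 3" "b' < 3" and r: "r < 5"
    have "(\<Sum>c\<in>C \<inter> triples. coefficient (hs b) r (ycoord c b) * ncoord c b') = 0"
      by (intro sum.neutral) (auto simp: ncoord_triples)
    moreover have "(\<Sum>c\<in>C \<inter> signeds b0. coefficient (hs b) r (ycoord c b) * ncoord c b')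
      = (if b0 = b then if r = 4 then 18 * coupling d b b' else 0 else 0)" if "b0 < 3" for b0
      using Kn[OF b(1) r b(2)] zero[of _ b0] by (cases "b0 = b") auto
    ultimately show "(\<Sum>c\<in>C. coefficient (hs b) r (ycoord c b) * ncoord c b')
      = (if r = 4 then 18 * coupling d b b' else 0)"
      using b by (simp add: sum_codes[OF sub])
  next
    fix p q :: nat assume p: "p < 3" "q < 3"
    have "(\<Sum>c\<in>C \<inter> triples. ncoord c p * ncoord c q) = 0"
      by (intro sum.neutral) (auto simp: ncoord_triples)
    then have "(\<Sum>c\<in>C. ncoord c p * ncoord c q)
      = (\<Sum>b<3. if p = b \<or> q = b then 0 else if p = q then 7 else d b)"
      using nn[OF _ p] by (simp add: sum_codes[OF sub])
    \<comment> \<open>A square receives 7 from each of two blocks, a mixed product only from the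
      block different from both \<open>p\<close> and \<open>q\<close>.\<close>
    also have "\<dots> = (if p = q then 14 else d (3 - p - q))"
      using less_3_cases[OF p(1)] less_3_cases[OF p(2)] by (elim disjE; simp add: sum_lessThan_3)
    finally show "(\<Sum>c\<in>C. ncoord c p * ncoord c q) = (if p = q then 14 else d (3 - p - q))" .
  qed (use d hs in blast)+
qed

section \<open>Orthogonal coordinates and the frame operator\<close>

definition frame_coord :: "(nat \<Rightarrow> nat list) \<Rightarrow> code \<Rightarrow> nat \<Rightarrow> int" where
  "frame_coord hs c a =
    (if a < 12 then coefficient (hs (a div 4)) (a mod 4) (ycoord c (a div 4))
     else if a < 15 then ncoord c (a - 12)
     else coefficient (hs (a - 15)) 4 (ycoord c (a - 15)))"

text \<open>The weights turn \<open>form / 18\<close> into a diagonal form: a Fourier vector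
  contributes one over 18 times its squared length, which is 6 for the alternating vectors, and an
  \<open>A_1\<close> coordinate contributes 18/18.\<close>

definition weight :: "nat \<Rightarrow> real" where
  "weight a = (if a < 12 then 1 / (18 * fourier_norm (a mod 4)) else if a < 15 then 1 else 1 / 108)"

lemma less_18_cases:
  fixes a :: nat
  assumes "a < 18"
  obtains b r where "b < 3" "r < 4" "a = 4 * b + r" "a < 12"
    | b where "b < 3" "a = 12 + b" | b where "b < 3" "a = 15 + b"
proof -
  consider "a < 12" | "12 \<le> a" "a < 15" | "15 \<le> a" by linarith
  then show ?thesis
    using that(1)[of "a div 4" "a mod 4"] that(2)[of "a - 12"] that(3)[of "a - 15"] assms
    by cases auto
qed

lemma sum_lessThan_18:
  fixes f :: "nat \<Rightarrow> 'a :: comm_monoid_add"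
  shows "(\<Sum>a<18. f a) = (\<Sum>b<3. (\<Sum>r<4. f (4 * b + r)) + f (12 + b) + f (15 + b))"
  by (simp add: eval_nat_numeral ac_simps)

lemma sum_ycoord:
  assumes "c \<in> codes" "b < 3"
  shows "(\<Sum>l<6. ycoord c b l) = 0"
proof (cases "c \<in> triples")
  case True
  have "(\<Sum>l<6. ycoord c b l) = (\<Sum>l<6. 1 - (if l = component b c then 6 else 0))"
    using True by (intro sum.cong) (auto simp: ycoord_triples)
  then show ?thesis using component_triples[OF True assms(2)] by (simp add: sum_subtractf)
next
  case False
  then obtain b' d s where "c = Signed b' d s" "s \<in> set half_signs"
    using assms(1) by (auto simp: codes_eq signeds_def)
  then show ?thesis by (cases "b = b'") (simp_all add: sum_half_signs flip: sum_distrib_left)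
qed

text \<open>Parseval in each block, with the coefficients 12/12, 12/4, 12/12, 12/4, 12/6 written
  out.\<close>

lemma form_eq_frame_coord:
  assumes "c \<in> codes" and hs: "\<And>b. b < 3 \<Longrightarrow> sort (hs b) = [0..<6]"
  shows "real_of_int (form c c') / 18 = (\<Sum>a<18. weight a * frame_coord hs c a * frame_coord hs c' a)"
proof -
  have block: "(\<Sum>r<4. weight (4 * b + r) * frame_coord hs c (4 * b + r) * frame_coord hs c' (4 * b + r))
      + weight (12 + b) * frame_coord hs c (12 + b) * frame_coord hs c' (12 + b)
      + weight (15 + b) * frame_coord hs c (15 + b) * frame_coord hs c' (15 + b)
      = real_of_int ((\<Sum>l<6. ycoord c b l * ycoord c' b l) + 18 * (ncoord c b * ncoord c' b)) / 18"
    if b: "b < 3" for b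
  proof -
    define k where "k r = real_of_int (coefficient (hs b) r (ycoord c b))" for r
    define k' where "k' r = real_of_int (coefficient (hs b) r (ycoord c' b))" for r
    define n where "n = real_of_int (ncoord c b * ncoord c' b)"
    have five: "(\<Sum>r<5. F r) = F 0 + F 1 + F 2 + F 3 + F (4 :: nat)" for F :: "nat \<Rightarrow> int"
      by (simp add: eval_nat_numeral)
    have "12 * real_of_int (\<Sum>l<6. ycoord c b l * ycoord c' b l)
      = real_of_int (\<Sum>r<5. (12 div fourier_norm r) * coefficient (hs b) r (ycoord c b) * coefficient (hs b) r (ycoord c' b))"
      unfolding parseval[OF hs[OF b] sum_ycoord[OF assms(1) b], of "ycoord c' b", symmetric]
      by (simp only: of_int_mult of_int_numeral)
    also have "\<dots> = k 0 * k' 0 + 3 * k 1 * k' 1 + k 2 * k' 2 + 3 * k 3 * k' 3 + 2 * k 4 * k' 4"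
      by (simp add: five fourier_norm_def k_def k'_def)
    finally have P: "real_of_int (\<Sum>l<6. ycoord c b l * ycoord c' b l)
      = (k 0 * k' 0 + 3 * k 1 * k' 1 + k 2 * k' 2 + 3 * k 3 * k' 3 + 2 * k 4 * k' 4) / 12" by simp
    have lt: "4 * b < 12" "4 * b + 1 < 12" "4 * b + 2 < 12" "4 * b + 3 < 12" "Suc (4 * b) < 12"
      using b by auto
    have md: "(4 * b + 1) div 4 = b" "(4 * b + 1) mod 4 = 1" "(4 * b + 2) div 4 = b" "(4 * b + 2) mod 4 = 2"
      "(4 * b + 3) div 4 = b" "(4 * b + 3) mod 4 = 3" by presburger+
    have F: "(\<Sum>r<4. weight (4 * b + r) * frame_coord hs c (4 * b + r) * frame_coord hs c' (4 * b + r))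
      = (k 0 * k' 0 + 3 * k 1 * k' 1 + k 2 * k' 2 + 3 * k 3 * k' 3) / 216"
      unfolding sum_lessThan_4 weight_def frame_coord_def
      using b by (simp only: lt md if_True) (simp add: fourier_norm_def k_def k'_def lt)
    show ?thesis
      unfolding F of_int_add P using b
      by (simp add: weight_def frame_coord_def flip: k_def k'_def)
  qed
  show ?thesis unfolding sum_lessThan_18 form_def of_int_sum[of _ "{..<3}"] sum_divide_distrib
    by (intro sum.cong refl) (rule block[symmetric], simp)
qed

text \<open>The second moments multiplied by the row weights; for instance 252/18 = 14, 324/18 = 18
  and 306 * 6 / 108 = 17.\<close>

lemma frame_operator:
  assumes C: "equiangular_codes C" and card: "card C \<ge> 57"
  obtains d hs where "card C = 57" "\<And>b. b < 3 \<Longrightarrow> d b \<in> {1, -1}"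
    "\<And>b. b < 3 \<Longrightarrow> sort (hs b) = [0..<6]"
    "\<And>i j. i < 18 \<Longrightarrow> j < 18 \<Longrightarrow>
      weight i * (\<Sum>c\<in>C. frame_coord hs c i * frame_coord hs c j) = frame_entry d i j"
proof (rule equiangular_codes_structure[OF C card])
  fix d hs
  assume "card C = 57" and d: "\<And>b. b < 3 \<Longrightarrow> d b \<in> {1, -1}"
    and hs: "\<And>b. b < 3 \<Longrightarrow> sort (hs b) = [0..<6]"
    and KK: "\<And>b b' r q. b < 3 \<Longrightarrow> b' < 3 \<Longrightarrow> r < 5 \<Longrightarrow> q < 5 \<Longrightarrow>
      (\<Sum>c\<in>C. coefficient (hs b) r (ycoord c b) * coefficient (hs b') q (ycoord c b'))
      = (if b = b' \<and> r = q then fourier_norm r * [252, 252, 324, 324, 306] ! r else 0)"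
    and Kn: "\<And>b b' r. b < 3 \<Longrightarrow> b' < 3 \<Longrightarrow> r < 5 \<Longrightarrow>
      (\<Sum>c\<in>C. coefficient (hs b) r (ycoord c b) * ncoord c b')
      = (if r = 4 then 18 * coupling d b b' else 0)"
    and nn: "\<And>p q. p < 3 \<Longrightarrow> q < 3 \<Longrightarrow> (\<Sum>c\<in>C. ncoord c p * ncoord c q) = (if p = q then 14 else d (3 - p - q))"
  have nK: "(\<Sum>c\<in>C. ncoord c b' * coefficient (hs b) r (ycoord c b)) = (if r = 4 then 18 * coupling d b b' else 0)"
    if "b < 3" "b' < 3" "r < 5" for b b' r
    using Kn[OF that] by (simp add: mult.commute)
  define fc where "fc = frame_coord hs"
  have fc: "fc c (4 * b + r) = coefficient (hs b) r (ycoord c b)" "fc c (12 + b) = ncoord c b"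
    "fc c (15 + b) = coefficient (hs b) 4 (ycoord c b)" if "b < 3" "r < 4" for b r c
    using that by (auto simp: fc_def frame_coord_def)
  have "weight i * (\<Sum>c\<in>C. fc c i * fc c j) = frame_entry d i j" if "i < 18" "j < 18" for i j
    using that(1)
  proof (cases rule: less_18_cases)
    case (1 b r)
    have w: "weight i = 1 / (18 * fourier_norm r)" using 1 by (simp add: weight_def)
    have i: "i mod 4 = r" using 1 by simp
    have r: "r = 0 \<or> r = 1 \<or> r = 2 \<or> r = 3" using \<open>r < 4\<close> by linarith
    show ?thesis using that(2)
    proof (cases rule: less_18_cases)
      case (1 b' r')
      have "i = j \<longleftrightarrow> b = b' \<and> r = r'"
        using \<open>i = _\<close> \<open>j = _\<close> \<open>r < 4\<close> \<open>r' < 4\<close> by presburger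
      then show ?thesis
        using KK[of b b' r r'] 1 \<open>b < 3\<close> \<open>r < 4\<close> r w i \<open>i = _\<close> \<open>i < 12\<close>
        by (auto simp: fc frame_entry_def fourier_norm_def)
    next
      case (2 b')
      then show ?thesis using Kn[of b b' r] \<open>b < 3\<close> \<open>r < 4\<close> \<open>i = _\<close> \<open>i < 12\<close>
        by (simp add: fc[of _ 0] fc(1) frame_entry_def)
    next
      case (3 b')
      then show ?thesis using KK[of b b' r 4] \<open>b < 3\<close> \<open>r < 4\<close> \<open>i = _\<close> \<open>i < 12\<close>
        by (simp add: fc[of _ 0] fc(1) frame_entry_def)
    qed
  next
    case (2 b)
    have w: "weight i = 1" using 2 by (simp add: weight_def)
    show ?thesis using that(2)
    proof (cases rule: less_18_cases)
      case (1 b' r')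
      then show ?thesis using nK[of b' b r'] 2
        by (simp add: fc[of _ 0] fc(1) frame_entry_def)
    next
      case (2 b')
      then show ?thesis using nn[of b b'] \<open>b < 3\<close> \<open>i = _\<close> w
        by (simp add: fc[of _ 0] frame_entry_def)
    next
      case (3 b')
      then show ?thesis using nK[of b' b 4] \<open>b < 3\<close> \<open>i = _\<close> w
        by (simp add: fc[of _ 0] frame_entry_def)
    qed
  next
    case (3 b)
    have w: "weight i = 1 / 108" using 3 by (simp add: weight_def)
    show ?thesis using that(2)
    proof (cases rule: less_18_cases)
      case (1 b' r')
      then show ?thesis using KK[of b b' 4 r'] 3
        by (simp add: fc[of _ 0] fc(1) frame_entry_def)
    next
      case (2 b')
      then show ?thesis using Kn[of b b' 4] \<open>b < 3\<close> \<open>i = _\<close> w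
        by (simp add: fc[of _ 0] frame_entry_def)
    next
      case (3 b')
      then show ?thesis using KK[of b b' 4 4] \<open>b < 3\<close> \<open>i = _\<close> w
        by (simp add: fc[of _ 0] frame_entry_def fourier_norm_def weight_def)
    qed
  qed
  then show ?thesis using that[OF \<open>card C = 57\<close> d hs] by (simp add: fc_def)
qed

section \<open>Coordinates of vectors of the lattice\<close>

text \<open>No integer congruent to 1 modulo 6 lies strictly between -5 and 1, so
  \<open>(z l - 1) * (z l + 5)\<close> is nonnegative; its linear part sums to zero.\<close>

lemma mod_6_1_squares:
  fixes z :: "nat \<Rightarrow> int"
  assumes "\<And>l. l < 6 \<Longrightarrow> z l mod 6 = 1" and "(\<Sum>l<6. z l) = 0"
  shows "(\<Sum>l<6. (z l)\<^sup>2) \<ge> 30"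
    and "(\<Sum>l<6. (z l)\<^sup>2) = 30 \<Longrightarrow> \<exists>t<6. \<forall>l<6. z l = (if l = t then -5 else 1)"
proof -
  have nonneg: "(z l - 1) * (z l + 5) \<ge> 0" if "l < 6" for l
  proof -
    have "z l \<ge> 1 \<or> z l \<le> -5" using assms(1)[OF that] by presburger
    then show ?thesis by (auto simp: zero_le_mult_iff)
  qed
  have sum: "(\<Sum>l<6. (z l - 1) * (z l + 5)) = (\<Sum>l<6. (z l)\<^sup>2) - 30"
    using assms(2) by (simp add: sum_lessThan_6 power2_eq_square algebra_simps)
  then show "(\<Sum>l<6. (z l)\<^sup>2) \<ge> 30" using sum_nonneg[of "{..<6}" "\<lambda>l. (z l - 1) * (z l + 5)"] nonneg by simp
  assume "(\<Sum>l<6. (z l)\<^sup>2) = 30"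
  then have "\<forall>l\<in>{..<6}. (z l - 1) * (z l + 5) = 0"
    using sum nonneg sum_nonneg_eq_0_iff[of "{..<6}" "\<lambda>l. (z l - 1) * (z l + 5)"] by simp
  then have z: "z l = 1 \<or> z l = -5" if "l < 6" for l using that by auto
  \<comment> \<open>All entries are now 1 or -5, and the sum zero leaves exactly one entry
    -5.\<close>
  have "(\<Sum>l<6. 1 - 6 * (if z l = -5 then 1 else 0)) = (\<Sum>l<6. z l)"
    by (intro sum.cong) (use z in auto)
  then have "6 * (\<Sum>l<6. if z l = -5 then 1 else 0 :: int) = 6"
    using assms(2) by (simp add: sum_subtractf flip: sum_distrib_left)
  also have "(\<Sum>l<6. if z l = -5 then 1 else 0 :: int) = int (card {l \<in> {..<6}. z l = -5})"
    by (subst sum.inter_filter[symmetric]) auto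
  finally have "card {l \<in> {..<6}. z l = -5} = 1" by simp
  then obtain t where t: "{l \<in> {..<6}. z l = -5} = {t}" by (auto simp: card_1_singleton_iff)
  then have "t < 6" "\<forall>l<6. z l = -5 \<longleftrightarrow> l = t" by blast+
  then show "\<exists>t<6. \<forall>l<6. z l = (if l = t then -5 else 1)" using z by metis
qed

text \<open>The same argument for the neighbours -2 and 4 in this residue class.\<close>

lemma mod_6_4_squares:
  fixes z :: "nat \<Rightarrow> int"
  assumes "\<And>l. l < 6 \<Longrightarrow> z l mod 6 = 4" and "(\<Sum>l<6. z l) = 0"
  shows "(\<Sum>l<6. (z l)\<^sup>2) \<ge> 48"
proof -
  have nonneg: "(z l + 2) * (z l - 4) \<ge> 0" if "l < 6" for l
  proof -
    have "z l \<ge> 4 \<or> z l \<le> -2" using assms(1)[OF that] by presburger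
    then show ?thesis by (auto simp: zero_le_mult_iff)
  qed
  have "(\<Sum>l<6. (z l + 2) * (z l - 4)) = (\<Sum>l<6. (z l)\<^sup>2) - 48"
    using assms(2) by (simp add: sum_lessThan_6 power2_eq_square algebra_simps)
  then show ?thesis using sum_nonneg[of "{..<6}" "\<lambda>l. (z l + 2) * (z l - 4)"] nonneg by simp
qed

lemma mod_6_3_squares:
  fixes z :: "nat \<Rightarrow> int"
  assumes "\<And>l. l < 6 \<Longrightarrow> z l mod 6 = 3"
  shows "(\<Sum>l<6. (z l)\<^sup>2) \<ge> 54"
    and "(\<Sum>l<6. (z l)\<^sup>2) = 54 \<Longrightarrow> l < 6 \<Longrightarrow> z l = 3 \<or> z l = -3"
proof -
  have nonneg: "(z l)\<^sup>2 - 9 \<ge> 0" if "l < 6" for l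
  proof -
    have "\<bar>z l\<bar> \<ge> \<bar>3\<bar>" using assms(1)[OF that] by presburger
    then show ?thesis using abs_le_square_iff[of 3 "z l"] by simp
  qed
  have sum: "(\<Sum>l<6. (z l)\<^sup>2 - 9) = (\<Sum>l<6. (z l)\<^sup>2) - 54" by (simp add: sum_subtractf)
  then show "(\<Sum>l<6. (z l)\<^sup>2) \<ge> 54" using sum_nonneg[of "{..<6}" "\<lambda>l. (z l)\<^sup>2 - 9"] nonneg by simp
  assume "(\<Sum>l<6. (z l)\<^sup>2) = 54" "l < 6"
  then have "(z l)\<^sup>2 - 9 = 0"
    using sum nonneg sum_nonneg_eq_0_iff[of "{..<6}" "\<lambda>l. (z l)\<^sup>2 - 9"] by simp
  then have "(z l)\<^sup>2 = 3\<^sup>2" by simp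
  then show "z l = 3 \<or> z l = -3" by (simp only: power2_eq_iff)
qed

text \<open>The integral form of the vectors of \<open>L\<close>: \<open>c\<^sub>0\<close> and \<open>c b\<close> are the coefficients of
  \<open>\<beta>\<^sub>0\<close> and \<open>\<beta>\<^bsub>b+1\<^esub>\<close>.\<close>

definition glue_conditions :: "int \<Rightarrow> (nat \<Rightarrow> int) \<Rightarrow> (nat \<Rightarrow> nat \<Rightarrow> int) \<Rightarrow> (nat \<Rightarrow> int) \<Rightarrow> bool" where
  "glue_conditions c0 c y n \<longleftrightarrow>
    (\<forall>b<3. (\<forall>l<6. 6 dvd y b l - (c0 + 3 * c b)) \<and> (\<Sum>l<6. y b l) = 0
      \<and> 2 dvd n b - (c 0 + c 1 + c 2 - c b)) \<and> 2 dvd n 3 - (c0 + c 0 + c 1 + c 2)"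

lemma glue_conditions_uminus:
  assumes glue: "glue_conditions c0 c y n"
  shows "glue_conditions (- c0) (\<lambda>b. - c b) (\<lambda>b l. - y b l) (\<lambda>b. - n b)"
  unfolding glue_conditions_def
  proof (intro conjI allI impI)
    fix b l :: nat assume "b < 3" "l < 6"
    then have "6 dvd - (y b l - (c0 + 3 * c b))"
      using glue unfolding dvd_minus_iff glue_conditions_def by blast
    also have "- (y b l - (c0 + 3 * c b)) = - y b l - (- c0 + 3 * - c b)" by linarith
    finally show "6 dvd - y b l - (- c0 + 3 * - c b)" .
  next
    fix b :: nat assume "b < 3"
    then show "(\<Sum>l<6. - y b l) = 0" using glue by (simp add: sum_negf glue_conditions_def)
    have "2 dvd - (n b - (c 0 + c 1 + c 2 - c b))"
      using glue \<open>b < 3\<close> unfolding dvd_minus_iff glue_conditions_def by blast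
    also have "- (n b - (c 0 + c 1 + c 2 - c b)) = - n b - (- c 0 + - c 1 + - c 2 - - c b)" by linarith
    finally show "2 dvd - n b - (- c 0 + - c 1 + - c 2 - - c b)" .
  next
    have "2 dvd - (n 3 - (c0 + c 0 + c 1 + c 2))"
      using glue unfolding dvd_minus_iff glue_conditions_def by blast
    also have "- (n 3 - (c0 + c 0 + c 1 + c 2)) = - n 3 - (- c0 + - c 0 + - c 1 + - c 2)" by linarith
    finally show "2 dvd - n 3 - (- c0 + - c 0 + - c 1 + - c 2)" .
  qed

lemma glue_conditions_add:
  assumes "glue_conditions c0 c y n" "glue_conditions c0' c' y' n'"
  shows "glue_conditions (c0 + c0') (\<lambda>b. c b + c' b) (\<lambda>b l. y b l + y' b l) (\<lambda>b. n b + n' b)"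
  unfolding glue_conditions_def
proof (intro conjI allI impI)
  fix b l :: nat assume "b < 3" "l < 6"
  then have "6 dvd (y b l - (c0 + 3 * c b)) + (y' b l - (c0' + 3 * c' b))"
    using assms unfolding glue_conditions_def by (intro dvd_add) blast+
  also have "\<dots> = y b l + y' b l - (c0 + c0' + 3 * (c b + c' b))" by simp
  finally show "6 dvd y b l + y' b l - (c0 + c0' + 3 * (c b + c' b))" .
next
  fix b :: nat assume "b < 3"
  then show "(\<Sum>l<6. y b l + y' b l) = 0" using assms by (simp add: sum.distrib glue_conditions_def)
  have "2 dvd (n b - (c 0 + c 1 + c 2 - c b)) + (n' b - (c' 0 + c' 1 + c' 2 - c' b))"
    using assms \<open>b < 3\<close> unfolding glue_conditions_def by (intro dvd_add) blast+
  also have "\<dots> = n b + n' b - (c 0 + c' 0 + (c 1 + c' 1) + (c 2 + c' 2) - (c b + c' b))" by linarith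
  finally show "2 dvd n b + n' b - (c 0 + c' 0 + (c 1 + c' 1) + (c 2 + c' 2) - (c b + c' b))" .
next
  have "2 dvd (n 3 - (c0 + c 0 + c 1 + c 2)) + (n' 3 - (c0' + c' 0 + c' 1 + c' 2))"
    using assms unfolding glue_conditions_def by (intro dvd_add) blast+
  also have "\<dots> = n 3 + n' 3 - (c0 + c0' + (c 0 + c' 0) + (c 1 + c' 1) + (c 2 + c' 2))" by linarith
  finally show "2 dvd n 3 + n' 3 - (c0 + c0' + (c 0 + c' 0) + (c 1 + c' 1) + (c 2 + c' 2))" .
qed

text \<open>The entries of block \<open>b\<close> are congruent to 1 or 4 modulo 6 as
  \<open>c0 + c b\<close> is odd or even, so its norm is at least 30 or 48. An even number of blocks
  is of the second type and two of them would exceed 90; so there is none, and 30 + 30 + 30 leaves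
  no room for \<open>A_1\<close> components.\<close>

lemma classify_nonzero:
  assumes glue: "glue_conditions c0 c y n" and odd: "odd (n 3)" and c0: "c0 mod 3 = 1"
    and norm: "(\<Sum>b<3. (\<Sum>l<6. (y b l)\<^sup>2) + 18 * (n b)\<^sup>2) = 90"
  shows "\<exists>x\<in>codes. \<forall>b<3. (\<forall>l<6. y b l = ycoord x b l) \<and> n b = ncoord x b"
proof -
  define Y where "Y b = (\<Sum>l<6. (y b l)\<^sup>2)" for b
  define q where "q b = (n b)\<^sup>2" for b
  have Y1: "Y b \<ge> 30" "Y b = 30 \<Longrightarrow> \<exists>t<6. \<forall>l<6. y b l = (if l = t then -5 else 1)"
    if "b < 3" "odd (c0 + c b)" for b
  proof -
    have "y b l mod 6 = 1" if "l < 6" for l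
    proof -
      have "6 dvd y b l - (c0 + 3 * c b)" using glue \<open>b < 3\<close> that by (simp add: glue_conditions_def)
      then show ?thesis using c0 \<open>odd (c0 + c b)\<close> by presburger
    qed
    moreover have "(\<Sum>l<6. y b l) = 0" using glue \<open>b < 3\<close> by (simp add: glue_conditions_def)
    ultimately show "Y b \<ge> 30" "Y b = 30 \<Longrightarrow> \<exists>t<6. \<forall>l<6. y b l = (if l = t then -5 else 1)"
      unfolding Y_def using mod_6_1_squares[of "y b"] by blast+
  qed
  have Y4: "Y b \<ge> 48" if "b < 3" "even (c0 + c b)" for b
  proof -
    have "y b l mod 6 = 4" if "l < 6" for l
    proof -
      have "6 dvd y b l - (c0 + 3 * c b)" using glue \<open>b < 3\<close> that by (simp add: glue_conditions_def)
      then show ?thesis using c0 \<open>even (c0 + c b)\<close> by presburger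
    qed
    moreover have "(\<Sum>l<6. y b l) = 0" using glue \<open>b < 3\<close> by (simp add: glue_conditions_def)
    ultimately show ?thesis unfolding Y_def by (rule mod_6_4_squares)
  qed
  have total: "Y 0 + Y 1 + Y 2 + 18 * q 0 + 18 * q 1 + 18 * q 2 = 90"
    using norm by (simp add: sum_lessThan_3 Y_def q_def)
  have sq: "q b \<ge> 0" for b by (simp add: q_def)
  have "2 dvd n 3 - (c0 + c 0 + c 1 + c 2)" using glue by (simp add: glue_conditions_def)
  then have parity: "odd (c0 + c 0 + c 1 + c 2)" using odd by presburger
  have le: "Y 0 + Y 1 + Y 2 \<le> 90" using total sq[of 0] sq[of 1] sq[of 2] by linarith
  have Y30: "Y b \<ge> 30" if "b < 3" for b using Y1(1)[OF that] Y4[OF that] by fastforce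
  have "\<not> (even (c0 + c 0) \<and> even (c0 + c 1))" "\<not> (even (c0 + c 0) \<and> even (c0 + c 2))"
    "\<not> (even (c0 + c 1) \<and> even (c0 + c 2))"
    using Y4[of 0] Y4[of 1] Y4[of 2] Y30[of 0] Y30[of 1] Y30[of 2] le by fastforce+
  with parity have odds: "odd (c0 + c 0)" "odd (c0 + c 1)" "odd (c0 + c 2)" by presburger+
  have "Y 0 = 30" "Y 1 = 30" "Y 2 = 30" "q 0 = 0" "q 1 = 0" "q 2 = 0"
    using total sq[of 0] sq[of 1] sq[of 2] Y30[of 0] Y30[of 1] Y30[of 2] by linarith+
  then have n: "n 0 = 0" "n 1 = 0" "n 2 = 0" and "Y 0 = 30" "Y 1 = 30" "Y 2 = 30" by (auto simp: q_def)
  then obtain i j k where "i < 6" "j < 6" "k < 6" "\<forall>l<6. y 0 l = (if l = i then -5 else 1)"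
    "\<forall>l<6. y 1 l = (if l = j then -5 else 1)" "\<forall>l<6. y 2 l = (if l = k then -5 else 1)"
    using Y1(2)[of 0] Y1(2)[of 1] Y1(2)[of 2] odds by auto
  then show ?thesis
    by (intro bexI[of _ "Triple i j k"]) (use n in \<open>auto simp: codes_def dest!: less_3_cases\<close>)
qed

text \<open>Now the entries of block \<open>b\<close> are congruent to 3 or 0 modulo 6, with norm at
  least 54 or 0. Blocks of the first type are odd in number and three would exceed 90; so there is
  one, and the \<open>A_1\<close> components at the other two blocks are odd.\<close>

lemma classify_zero:
  assumes glue: "glue_conditions c0 c y n" and odd: "odd (n 3)" and c0: "c0 mod 3 = 0"
    and norm: "(\<Sum>b<3. (\<Sum>l<6. (y b l)\<^sup>2) + 18 * (n b)\<^sup>2) = 90"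
  shows "\<exists>e\<in>{1, -1}. \<exists>x\<in>codes. \<forall>b<3. (\<forall>l<6. y b l = e * ycoord x b l) \<and> n b = e * ncoord x b"
proof -
  define Y where "Y b = (\<Sum>l<6. (y b l)\<^sup>2)" for b
  define q where "q b = (n b)\<^sup>2" for b
  have Y3: "Y b \<ge> 54" "Y b = 54 \<Longrightarrow> l < 6 \<Longrightarrow> y b l = 3 \<or> y b l = -3"
    if "b < 3" "odd (c0 + c b)" for b l
  proof -
    have "y b l mod 6 = 3" if "l < 6" for l
    proof -
      have "6 dvd y b l - (c0 + 3 * c b)" using glue \<open>b < 3\<close> that by (simp add: glue_conditions_def)
      then show ?thesis using c0 \<open>odd (c0 + c b)\<close> by presburger
    qed
    then show "Y b \<ge> 54" "Y b = 54 \<Longrightarrow> l < 6 \<Longrightarrow> y b l = 3 \<or> y b l = -3"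
      unfolding Y_def using mod_6_3_squares[of "y b"] by blast+
  qed
  have Y0: "Y b \<ge> 0" for b unfolding Y_def by (intro sum_nonneg) simp
  have sq: "q b \<ge> 0" for b by (simp add: q_def)
  have sq1: "q b \<ge> 1" if "odd (n b)" for b
  proof -
    have "n b \<noteq> 0" using that by auto
    then have "q b > 0" by (simp add: q_def)
    then show ?thesis by linarith
  qed
  have "2 dvd n 3 - (c0 + c 0 + c 1 + c 2)" using glue by (simp add: glue_conditions_def)
  then have parity: "odd (c0 + c 0 + c 1 + c 2)" using odd by presburger
  have par_n: "2 dvd n b - (c 0 + c 1 + c 2 - c b)" if "b < 3" for b
    using glue that by (simp add: glue_conditions_def)
  obtain b1 b2 b3 where b: "b1 < 3" "b2 = (b1 + 1) mod 3" "b3 = (b1 + 2) mod 3"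
    and par: "odd (c0 + c b1)" "even (c0 + c b2)" "even (c0 + c b3)"
  proof -
    have total: "Y 0 + Y 1 + Y 2 + 18 * q 0 + 18 * q 1 + 18 * q 2 = 90"
      using norm by (simp add: sum_lessThan_3 Y_def q_def)
    have "\<not> (odd (c0 + c 0) \<and> odd (c0 + c 1) \<and> odd (c0 + c 2))"
    proof
      assume *: "odd (c0 + c 0) \<and> odd (c0 + c 1) \<and> odd (c0 + c 2)"
      have "Y 0 \<ge> 54" "Y 1 \<ge> 54" "Y 2 \<ge> 54" by (rule Y3(1), simp, use * in blast)+
      then show False using total sq[of 0] sq[of 1] sq[of 2] by linarith
    qed
    then have "odd (c0 + c 0) \<and> even (c0 + c 1) \<and> even (c0 + c 2)
      \<or> odd (c0 + c 1) \<and> even (c0 + c 0) \<and> even (c0 + c 2)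
      \<or> odd (c0 + c 2) \<and> even (c0 + c 0) \<and> even (c0 + c 1)"
      using parity unfolding even_add by argo
    then show ?thesis
    proof (elim disjE conjE)
      assume "odd (c0 + c 0)" "even (c0 + c 1)" "even (c0 + c 2)"
      then show ?thesis by (intro that[of 0 1 2]) simp_all
    next
      assume "odd (c0 + c 1)" "even (c0 + c 0)" "even (c0 + c 2)"
      then show ?thesis by (intro that[of 1 2 0]) simp_all
    next
      assume "odd (c0 + c 2)" "even (c0 + c 0)" "even (c0 + c 1)"
      then show ?thesis by (intro that[of 2 0 1]) simp_all
    qed
  qed
  have perm: "b1 = 0 \<and> b2 = 1 \<and> b3 = 2 \<or> b1 = 1 \<and> b2 = 2 \<and> b3 = 0 \<or> b1 = 2 \<and> b2 = 0 \<and> b3 = 1"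
    using less_3_cases[OF b(1)] b(2,3) by auto
  then have b23: "b2 < 3" "b3 < 3" "b1 \<noteq> b2" "b1 \<noteq> b3" "b2 \<noteq> b3" by auto
  have total: "Y b1 + Y b2 + Y b3 + 18 * q b1 + 18 * q b2 + 18 * q b3 = 90"
    using norm perm by (auto simp: sum_lessThan_3 Y_def q_def)
  have "c 0 + c 1 + c 2 = c b1 + c b2 + c b3" using perm by auto
  then have "odd (n b2)" "odd (n b3)"
    using par_n[OF b23(1)] par_n[OF b23(2)] par by presburger+
  \<comment> \<open>The lower bounds 54 + 18 + 18 already exhaust the norm 90.\<close>
  then have eqs: "Y b1 = 54" "Y b2 = 0" "Y b3 = 0" "q b1 = 0" "q b2 = 1" "q b3 = 1"
    using total Y3(1)[OF b(1) par(1)] Y0[of b2] Y0[of b3] sq1[of b2] sq1[of b3] sq[of b1] by linarith+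
  \<comment> \<open>\<open>e\<close> normalises the component at \<open>b1 + 1\<close> to 1, as
    \<open>ncoord\<close> demands; \<open>d\<close> is the remaining relative sign.\<close>
  define e where "e = n b2"
  define d where "d = e * n b3"
  define s where "s = map (\<lambda>l. e * (if y b1 l = 3 then 1 else -1)) [0..<6]"
  have e: "e \<in> {1, -1}" "e * e = 1" using eqs(5) by (auto simp: e_def q_def power2_eq_1_iff)
  have n3: "n b3 = 1 \<or> n b3 = -1" using eqs(6) by (auto simp: q_def power2_eq_1_iff)
  have y0: "y b' l = 0" if "Y b' = 0" "l < 6" for b' l
    using that sum_nonneg_eq_0_iff[of "{..<6}" "\<lambda>l. (y b' l)\<^sup>2"] by (auto simp: Y_def)
  have s: "e * (3 * s ! l) = y b1 l" if "l < 6" for l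
    using Y3(2)[OF b(1) par(1) eqs(1) that] that e(1) by (auto simp: s_def)
  have "e * (3 * sum_list s) = (\<Sum>l<6. e * (3 * s ! l))"
    by (simp add: sum_list_sum_nth atLeast0LessThan s_def flip: sum_distrib_left)
  also have "\<dots> = (\<Sum>l<6. y b1 l)" using s by (intro sum.cong) auto
  also have "\<dots> = 0" using glue b(1) by (simp add: glue_conditions_def)
  finally have "sum_list s = 0" using e(1) by auto
  moreover have "set s \<subseteq> {1, -1}" using e(1) by (auto simp: s_def split: if_splits)
  ultimately have "s \<in> set half_signs" by (simp add: set_half_signs s_def)
  then have "Signed b1 d s \<in> codes" using b(1) e(1) n3 by (auto simp: codes_def d_def)
  moreover have "(\<forall>l<6. y b' l = e * ycoord (Signed b1 d s) b' l) \<and> n b' = e * ncoord (Signed b1 d s) b'"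
    if "b' < 3" for b'
  proof -
    have "b' = b1 \<or> b' = b2 \<or> b' = b3" using less_3_cases[OF that] perm by auto
    then consider "b' = b1" | "b' = b2" | "b' = b3" by blast
    then show ?thesis
    proof cases
      case 1
      then show ?thesis using s eqs(4) by (simp add: q_def)
    next
      case 2
      then show ?thesis using y0[OF eqs(2)] b23 b(2) by (simp add: e_def)
    next
      case 3
      then show ?thesis using y0[OF eqs(3)] b23 b(2) e(2) by (simp add: d_def flip: mult.assoc)
    qed
  qed
  ultimately show ?thesis using e(1) by blast
qed

text \<open>The residue 2 of \<open>c0\<close> modulo 3 is reduced to the residue 1 by negating the
  vector.\<close>

lemma classify:
  assumes glue: "glue_conditions c0 c y n" and odd: "odd (n 3)"
    and norm: "(\<Sum>b<3. (\<Sum>l<6. (y b l)\<^sup>2) + 18 * (n b)\<^sup>2) = 90"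
  shows "\<exists>e\<in>{1, -1}. \<exists>x\<in>codes. \<forall>b<3. (\<forall>l<6. y b l = e * ycoord x b l) \<and> n b = e * ncoord x b"
proof -
  have "c0 mod 3 = 0 \<or> c0 mod 3 = 1 \<or> (- c0) mod 3 = 1" by presburger
  then consider "c0 mod 3 = 0" | "c0 mod 3 = 1" | "(- c0) mod 3 = 1" by blast
  then show ?thesis
  proof cases
    case 1
    then show ?thesis by (rule classify_zero[OF glue odd _ norm])
  next
    case 2
    then show ?thesis using classify_nonzero[OF glue odd _ norm] by auto
  next
    case 3
    have nm: "(\<Sum>b<3. (\<Sum>l<6. (- y b l)\<^sup>2) + 18 * (- n b)\<^sup>2) = 90" using norm by simp
    have "odd (- n 3)" using odd by simp
    then obtain x where "x \<in> codes" and
      "\<forall>b<3. (\<forall>l<6. - y b l = ycoord x b l) \<and> - n b = ncoord x b"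
      using classify_nonzero[OF glue_conditions_uminus[OF glue] _ 3 nm] by blast
    then have "\<forall>b<3. (\<forall>l<6. y b l = -1 * ycoord x b l) \<and> n b = -1 * ncoord x b"
      by fastforce
    then show ?thesis using \<open>x \<in> codes\<close> by blast
  qed
qed

section \<open>Passage between lattice vectors and integer coordinates\<close>

lemma less_4_cases: "b < 4 \<Longrightarrow> b = 0 \<or> b = 1 \<or> b = 2 \<or> b = (3 :: nat)"
  by linarith

lemma blocks_nth:
  assumes "v1 \<in> carrier_vec 6" "v2 \<in> carrier_vec 6" "v3 \<in> carrier_vec 6"
    "v4 \<in> carrier_vec 2" "v5 \<in> carrier_vec 2" "v6 \<in> carrier_vec 2" "v7 \<in> carrier_vec 2"
  shows "blocks v1 v2 v3 v4 v5 v6 v7 \<in> carrier_vec 26"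
    and "b < 3 \<Longrightarrow> l < 6 \<Longrightarrow> blocks v1 v2 v3 v4 v5 v6 v7 $ (6 * b + l) = [v1, v2, v3] ! b $ l"
    and "b < 4 \<Longrightarrow> blocks v1 v2 v3 v4 v5 v6 v7 $ (18 + 2 * b) = [v4, v5, v6, v7] ! b $ 0"
    and "b < 4 \<Longrightarrow> blocks v1 v2 v3 v4 v5 v6 v7 $ (19 + 2 * b) = [v4, v5, v6, v7] ! b $ 1"
proof -
  note dims = assms[THEN carrier_vecD]
  show "blocks v1 v2 v3 v4 v5 v6 v7 \<in> carrier_vec 26"
    by (intro carrier_vecI) (simp add: blocks_def dims)
  show "blocks v1 v2 v3 v4 v5 v6 v7 $ (6 * b + l) = [v1, v2, v3] ! b $ l" if "b < 3" "l < 6"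
    using less_3_cases[OF that(1)] that(2) by (elim disjE) (simp_all add: blocks_def dims)
  show "blocks v1 v2 v3 v4 v5 v6 v7 $ (18 + 2 * b) = [v4, v5, v6, v7] ! b $ 0" if "b < 4"
    using less_4_cases[OF that] by (elim disjE) (simp_all add: blocks_def dims)
  show "blocks v1 v2 v3 v4 v5 v6 v7 $ (19 + 2 * b) = [v4, v5, v6, v7] ! b $ 1" if "b < 4"
    using less_4_cases[OF that] by (elim disjE) (simp_all add: blocks_def dims)
qed

lemma less_26_cases:
  fixes i :: nat
  assumes "i < 26"
  obtains b l where "b < 3" "l < 6" "i = 6 * b + l"
    | b where "b < 4" "i = 18 + 2 * b" | b where "b < 4" "i = 19 + 2 * b"
proof (cases "i < 18")
  case True
  then show ?thesis using that(1)[of "i div 6" "i mod 6"] by auto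
next
  case False
  show ?thesis
  proof (cases "even i")
    case True
    then show ?thesis using that(2)[of "(i - 18) div 2"] False assms by auto
  next
    case odd: False
    then obtain k where "i = 2 * k + 1" by (rule oddE)
    then show ?thesis using that(3)[of "k - 9"] False assms by auto
  qed
qed

lemma scalar_prod_26:
  fixes u v :: "real vec"
  assumes "v \<in> carrier_vec 26"
  shows "u \<bullet> v = (\<Sum>b<3. \<Sum>l<6. u $ (6 * b + l) * v $ (6 * b + l))
    + (\<Sum>b<4. u $ (18 + 2 * b) * v $ (18 + 2 * b) + u $ (19 + 2 * b) * v $ (19 + 2 * b))"
  using assms by (simp add: scalar_prod_def eval_nat_numeral)

definition has_coords :: "real vec \<Rightarrow> (nat \<Rightarrow> nat \<Rightarrow> int) \<Rightarrow> (nat \<Rightarrow> int) \<Rightarrow> bool" where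
  "has_coords u y n \<longleftrightarrow> u \<in> carrier_vec 26 \<and> (\<forall>b<3. \<forall>l<6. u $ (6 * b + l) = y b l / 6)
    \<and> (\<forall>b<4. u $ (18 + 2 * b) = n b / 2 \<and> u $ (19 + 2 * b) = - (n b / 2))"

lemma has_coords_add:
  "has_coords u y n \<Longrightarrow> has_coords v y' n' \<Longrightarrow> has_coords (u + v) (\<lambda>b l. y b l + y' b l) (\<lambda>b. n b + n' b)"
  by (auto simp: has_coords_def field_simps)

lemma has_coords_uminus:
  "has_coords u y n \<Longrightarrow> has_coords (- u) (\<lambda>b l. - y b l) (\<lambda>b. - n b)"
  by (auto simp: has_coords_def)

lemma scalar_prod_has_coords:
  assumes "has_coords u y n" "has_coords v y' n'"
  shows "36 * (u \<bullet> v) = of_int ((\<Sum>b<3. \<Sum>l<6. y b l * y' b l) + 18 * (\<Sum>b<4. n b * n' b))"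
proof -
  have "u \<bullet> v = (\<Sum>b<3. \<Sum>l<6. y b l / 6 * (y' b l / 6)) + (\<Sum>b<4. n b / 2 * (n' b / 2) + - (n b / 2) * - (n' b / 2))"
  proof -
    have v: "v \<in> carrier_vec 26" using assms(2) by (simp add: has_coords_def)
    show ?thesis
      unfolding scalar_prod_26[OF v] using assms[unfolded has_coords_def]
      by (intro arg_cong2[of _ _ _ _ "(+)"] sum.cong refl) (simp_all only: lessThan_iff)
  qed
  also have "\<dots> = (\<Sum>b<3. \<Sum>l<6. y b l * y' b l / 36) + (\<Sum>b<4. n b * n' b / 2)"
    by simp
  finally show ?thesis by (simp add: sum_distrib_left)
qed

lemma has_coords_rho: "has_coords rho (\<lambda>_ _. 0) (\<lambda>b. if b = 3 then 2 else 0)"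
  unfolding has_coords_def rho_def
  by (auto simp: blocks_nth alpha_def dest!: less_3_cases less_4_cases)

lemma has_coords_beta0:
  "has_coords beta0 (\<lambda>_ l. if l = 5 then -5 else 1) (\<lambda>b. if b = 3 then 1 else 0)"
  unfolding has_coords_def beta0_def
  by (auto simp: blocks_nth alpha_def dest!: less_3_cases less_4_cases)

definition beta_y :: "nat \<Rightarrow> nat \<Rightarrow> nat \<Rightarrow> int" where
  "beta_y k b l = (if b = k then if l = 5 then -15 else 3 else 0)"

definition beta_n :: "nat \<Rightarrow> nat \<Rightarrow> int" where
  "beta_n k b = (if b = k then 0 else 1)"

lemma has_coords_betas:
  "has_coords beta1 (beta_y 0) (beta_n 0)" "has_coords beta2 (beta_y 1) (beta_n 1)"
  "has_coords beta3 (beta_y 2) (beta_n 2)"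
  unfolding has_coords_def beta1_def beta2_def beta3_def
  by (auto simp: blocks_nth alpha_def beta_y_def beta_n_def dest!: less_3_cases less_4_cases)

lemma has_coords_Lambda:
  assumes "u \<in> Lambda"
  obtains y n where "has_coords u (\<lambda>b l. 6 * y b l) (\<lambda>b. 2 * n b)" "\<And>b. b < 3 \<Longrightarrow> (\<Sum>l<6. y b l) = 0"
proof -
  obtain v1 v2 v3 v4 v5 v6 v7 where u: "u = blocks v1 v2 v3 v4 v5 v6 v7"
    and v: "v1 \<in> A_lattice 5" "v2 \<in> A_lattice 5" "v3 \<in> A_lattice 5"
      "v4 \<in> A_lattice 1" "v5 \<in> A_lattice 1" "v6 \<in> A_lattice 1" "v7 \<in> A_lattice 1"
    using assms by (auto simp: Lambda_def)
  have A5: "v \<in> carrier_vec 6" "l < 6 \<Longrightarrow> of_int \<lfloor>v $ l\<rfloor> = v $ l" "(\<Sum>l<6. \<lfloor>v $ l\<rfloor>) = 0"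
    if "v \<in> A_lattice 5" for v l
  proof -
    show "v \<in> carrier_vec 6" using that by (simp add: A_lattice_def)
    show fl: "of_int \<lfloor>v $ l\<rfloor> = v $ l" if "l < 6" for l
      using that \<open>v \<in> A_lattice 5\<close> by (auto simp: A_lattice_def elim!: Ints_cases)
    have "(\<Sum>l<6. v $ l) = 0" using that by (simp add: A_lattice_def)
    moreover have "real_of_int (\<Sum>l<6. \<lfloor>v $ l\<rfloor>) = (\<Sum>l<6. v $ l)"
      unfolding of_int_sum by (intro sum.cong) (use fl in auto)
    ultimately show "(\<Sum>l<6. \<lfloor>v $ l\<rfloor>) = 0" by (simp only: of_int_eq_0_iff)
  qed
  have A1: "v \<in> carrier_vec 2" "of_int \<lfloor>v $ 0\<rfloor> = v $ 0" "v $ 1 = - v $ 0"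
    if "v \<in> A_lattice 1" for v
    using that by (auto simp: A_lattice_def numeral_2_eq_2 elim!: Ints_cases)
  define y where "y b l = \<lfloor>[v1, v2, v3] ! b $ l\<rfloor>" for b l
  define n where "n b = \<lfloor>[v4, v5, v6, v7] ! b $ 0\<rfloor>" for b
  have V: "[v1, v2, v3] ! b \<in> A_lattice 5" if "b < 3" for b
    using v less_3_cases[OF that] by auto
  have W: "[v4, v5, v6, v7] ! b \<in> A_lattice 1" if "b < 4" for b
    using v less_4_cases[OF that] by (elim disjE) simp_all
  note nth = blocks_nth[OF A5(1)[OF v(1)] A5(1)[OF v(2)] A5(1)[OF v(3)]
      A1(1)[OF v(4)] A1(1)[OF v(5)] A1(1)[OF v(6)] A1(1)[OF v(7)]]
  have "has_coords u (\<lambda>b l. 6 * y b l) (\<lambda>b. 2 * n b)"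
    unfolding has_coords_def
  proof (intro conjI allI impI)
    show "u \<in> carrier_vec 26" using nth(1) by (simp add: u)
    show "u $ (6 * b + l) = real_of_int (6 * y b l) / 6" if "b < 3" "l < 6" for b l
      using nth(2)[OF that] A5(2)[OF V[OF that(1)] that(2)] by (simp only: u y_def of_int_mult; simp?)
    show "u $ (18 + 2 * b) = real_of_int (2 * n b) / 2" if "b < 4" for b
      using nth(3)[OF that] A1(2)[OF W[OF that]] by (simp only: u n_def of_int_mult; simp?)
    show "u $ (19 + 2 * b) = - (real_of_int (2 * n b) / 2)" if "b < 4" for b
      using nth(4)[OF that] A1(2,3)[OF W[OF that]] by (simp only: u n_def of_int_mult; simp?)
  qed
  moreover have "(\<Sum>l<6. y b l) = 0" if "b < 3" for b
    using less_3_cases[OF that] A5(3) v by (auto simp: y_def)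
  ultimately show ?thesis by (rule that)
qed

lemma inv_monoid_vec:
  fixes v :: "real vec"
  assumes "v \<in> carrier_vec n"
  shows "inv\<^bsub>monoid_vec TYPE(real) n\<^esub> v = - v"
proof -
  interpret comm_group "monoid_vec TYPE(real) n" by (rule comm_group_vec)
  show ?thesis by (rule inv_equality) (use assms in \<open>auto simp: monoid_vec_simps\<close>)
qed

text \<open>The congruences hold for the generators and are preserved by the group
  operations.\<close>

lemma L_has_coords:
  assumes "u \<in> L"
  shows "\<exists>c0 c y n. has_coords u y n \<and> glue_conditions c0 c y n"
proof -
  let ?P = "\<lambda>u. \<exists>c0 c y n. has_coords u y n \<and> glue_conditions c0 c y n"
  have I: "?P u" if "has_coords u y n" "glue_conditions c0 c y n" for u y n c0 c
    by (intro exI conjI) (fact that)+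
  have Lam: "?P u" if "u \<in> Lambda" for u
  proof (rule has_coords_Lambda[OF that])
    fix y n assume yn: "has_coords u (\<lambda>b l. 6 * y b l) (\<lambda>b. 2 * n b)" "\<And>b. b < 3 \<Longrightarrow> (\<Sum>l<6. y b l) = 0"
    have "glue_conditions 0 (\<lambda>_. 0) (\<lambda>b l. 6 * y b l) (\<lambda>b. 2 * n b)"
      using yn(2) by (simp add: glue_conditions_def flip: sum_distrib_left)
    then show ?thesis by (rule I[OF yn(1)])
  qed
  have "glue_conditions 1 (\<lambda>_. 0) (\<lambda>_ l. if l = 5 then -5 else 1) (\<lambda>b. if b = 3 then 1 else 0)"
    by (simp add: glue_conditions_def sum_lessThan_6)
  then have b0: "?P beta0" by (rule I[OF has_coords_beta0])
  have b: "glue_conditions 0 (\<lambda>b. if b = k then 1 else 0) (beta_y k) (beta_n k)" if "k < 3" for k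
    using less_3_cases[OF that]
    by (auto simp: glue_conditions_def beta_y_def beta_n_def sum_lessThan_6 dest!: less_3_cases)
  have b1: "?P beta1" by (rule I[OF has_coords_betas(1) b]) simp
  have b2: "?P beta2" by (rule I[OF has_coords_betas(2) b]) simp
  have b3: "?P beta3" by (rule I[OF has_coords_betas(3) b]) simp
  have base: "?P u" if "u \<in> Lambda \<union> {beta0, beta1, beta2, beta3}" for u
    using that by (elim UnE insertE emptyE) (simp_all only: Lam b0 b1 b2 b3)
  show ?thesis using assms unfolding L_def
  proof (induction rule: generate.induct)
    case one
    have "has_coords (0\<^sub>v 26) (\<lambda>_ _. 0) (\<lambda>_. 0)" by (simp add: has_coords_def)
    moreover have "glue_conditions 0 (\<lambda>_. 0) (\<lambda>_ _. 0) (\<lambda>_. 0)" by (simp add: glue_conditions_def)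
    ultimately show ?case unfolding monoid_vec_simps by (rule I)
  next
    case (incl h)
    then show ?case by (rule base)
  next
    case (inv h)
    then obtain c0 c y n where h: "has_coords h y n" "glue_conditions c0 c y n"
      using base[OF inv] by (elim exE conjE)
    have "inv\<^bsub>monoid_vec TYPE(real) 26\<^esub> h = - h" using h(1) by (simp add: inv_monoid_vec has_coords_def)
    then show ?case using I[OF has_coords_uminus[OF h(1)] glue_conditions_uminus[OF h(2)]] by simp
  next
    case (eng h1 h2)
    obtain c0 c y n where h1: "has_coords h1 y n" "glue_conditions c0 c y n"
      using eng(3) by (elim exE conjE)
    obtain c0' c' y' n' where h2: "has_coords h2 y' n'" "glue_conditions c0' c' y' n'"
      using eng(4) by (elim exE conjE)
    show ?case unfolding monoid_vec_simps
      by (rule I[OF has_coords_add[OF h1(1) h2(1)] glue_conditions_add[OF h1(2) h2(2)]])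
  qed
qed

text \<open>The product with \<open>rho\<close> fixes \<open>n 3 = 1\<close>. Of the scaled norm 36
  * 3 = 108 this takes 18, which leaves the 90 of the classification.\<close>

lemma L_code:
  assumes "u \<in> L" "u \<bullet> rho = 1" "u \<bullet> u = 3"
  shows "\<exists>e\<in>{1, -1}. \<exists>x\<in>codes. has_coords u (\<lambda>b l. e * ycoord x b l) (\<lambda>b. if b = 3 then 1 else e * ncoord x b)"
proof -
  obtain c0 c y n where u: "has_coords u y n" and glue: "glue_conditions c0 c y n"
    using L_has_coords[OF assms(1)] by blast
  have "36 * (u \<bullet> rho) = of_int (36 * n 3)"
    unfolding scalar_prod_has_coords[OF u has_coords_rho] by (simp add: sum_lessThan_4)
  then have n3: "n 3 = 1" using assms(2) by simp
  have "real_of_int 108 = of_int ((\<Sum>b<3. \<Sum>l<6. y b l * y b l) + 18 * (\<Sum>b<4. n b * n b))"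
    using scalar_prod_has_coords[OF u u] assms(3) by simp
  then have "108 = (\<Sum>b<3. \<Sum>l<6. y b l * y b l) + 18 * (\<Sum>b<4. n b * n b)"
    unfolding of_int_eq_iff .
  then have norm: "(\<Sum>b<3. (\<Sum>l<6. (y b l)\<^sup>2) + 18 * (n b)\<^sup>2) = 90"
    by (simp add: sum_lessThan_4 n3 sum_lessThan_3 power2_eq_square)
  have "odd (n 3)" using n3 by simp
  from classify[OF glue this norm] obtain e x where e: "e \<in> {1, -1}" "x \<in> codes"
    and yn: "\<forall>b<3. (\<forall>l<6. y b l = e * ycoord x b l) \<and> n b = e * ncoord x b" by blast
  have "has_coords u (\<lambda>b l. e * ycoord x b l) (\<lambda>b. if b = 3 then 1 else e * ncoord x b)"
    using u yn n3 unfolding has_coords_def by (auto dest!: less_4_cases)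
  with e show ?thesis by blast
qed

text \<open>The summand 1/2 comes from the last \<open>A_1\<close> block, where both vectors have
  the component \<alpha>_1.\<close>

lemma scalar_prod_codes:
  assumes "has_coords u (\<lambda>b l. e * ycoord x b l) (\<lambda>b. if b = 3 then 1 else e * ncoord x b)"
    and "has_coords v (\<lambda>b l. e' * ycoord x' b l) (\<lambda>b. if b = 3 then 1 else e' * ncoord x' b)"
  shows "u \<bullet> v = 1 / 2 + of_int (e * e' * form x x') / 36"
proof -
  have split: "(\<Sum>b<4. f b) = (\<Sum>b<3. f b) + f (3 :: nat)" for f :: "nat \<Rightarrow> int"
    by (simp add: eval_nat_numeral)
  have "(\<Sum>b<3. \<Sum>l<6. (e * ycoord x b l) * (e' * ycoord x' b l))
      + 18 * (\<Sum>b<3. (e * ncoord x b) * (e' * ncoord x' b)) = e * e' * form x x'"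
    unfolding form_def sum.distrib distrib_left by (simp add: sum_distrib_left ac_simps)
  then have "36 * (u \<bullet> v) = of_int (e * e' * form x x' + 18)"
    unfolding scalar_prod_has_coords[OF assms] split by (simp del: of_int_mult of_int_sum)
  then show ?thesis by simp
qed

lemma in_Lambda:
  assumes u: "has_coords u (\<lambda>b l. 6 * y b l) (\<lambda>b. 2 * n b)" and sum: "\<And>b. b < 3 \<Longrightarrow> (\<Sum>l<6. y b l) = 0"
  shows "u \<in> Lambda"
proof -
  define v where "v b = vec 6 (\<lambda>l. real_of_int (y b l))" for b
  define w where "w b = vec 2 (\<lambda>l. if l = 0 then real_of_int (n b) else - n b)" for b
  have carrier: "v b \<in> carrier_vec 6" "w b \<in> carrier_vec 2" for b by (simp_all add: v_def w_def)
  note nth = blocks_nth[OF carrier(1) carrier(1) carrier(1) carrier(2) carrier(2) carrier(2) carrier(2)]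
  have eq: "u = blocks (v 0) (v 1) (v 2) (w 0) (w 1) (w 2) (w 3)" (is "_ = ?B")
  proof (rule eq_vecI)
    fix i assume "i < dim_vec ?B"
    then have "i < 26" using nth(1) by (metis carrier_vecD)
    then show "u $ i = ?B $ i"
    proof (cases rule: less_26_cases)
      case (1 b l)
      have "?B $ i = [v 0, v 1, v 2] ! b $ l" unfolding 1(3) by (rule nth(2)[OF 1(1,2)])
      also have "[v 0, v 1, v 2] ! b = v b" using less_3_cases[OF 1(1)] by auto
      finally show ?thesis using u 1 by (simp add: has_coords_def v_def)
    next
      case (2 b)
      have "?B $ i = [w 0, w 1, w 2, w 3] ! b $ 0" unfolding 2(2) by (rule nth(3)[OF 2(1)])
      also have "[w 0, w 1, w 2, w 3] ! b = w b" using less_4_cases[OF 2(1)] by auto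
      finally show ?thesis using u 2 by (simp add: has_coords_def w_def)
    next
      case (3 b)
      have "?B $ i = [w 0, w 1, w 2, w 3] ! b $ 1" unfolding 3(2) by (rule nth(4)[OF 3(1)])
      also have "[w 0, w 1, w 2, w 3] ! b = w b" using less_4_cases[OF 3(1)] by auto
      finally show ?thesis using u 3 by (simp add: has_coords_def w_def)
    qed
  next
    show "dim_vec u = dim_vec ?B" using u nth(1) by (metis carrier_vecD has_coords_def)
  qed
  have V: "v b \<in> A_lattice 5" if "b < 3" for b
    using sum[OF that] by (auto simp: A_lattice_def v_def simp flip: of_int_sum)
  have W: "w b \<in> A_lattice 1" for b
    by (auto simp: A_lattice_def w_def numeral_2_eq_2 less_Suc_eq)
  show ?thesis
    unfolding Lambda_def by (intro CollectI exI conjI, rule eq, (rule V, simp)+, (rule W)+)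
qed

text \<open>A criterion with a single glue vector \<open>g\<close>: the congruences put
  \<open>u - g\<close> into \<open>Lambda\<close>.\<close>

lemma in_L:
  assumes g: "g \<in> {beta0, beta1, beta2, beta3}" "has_coords g y' n'" and u: "has_coords u y n"
    and y: "\<And>b l. b < 3 \<Longrightarrow> l < 6 \<Longrightarrow> 6 dvd y b l - y' b l"
    and sums: "\<And>b. b < 3 \<Longrightarrow> (\<Sum>l<6. y b l) = 0" "\<And>b. b < 3 \<Longrightarrow> (\<Sum>l<6. y' b l) = 0"
    and n: "\<And>b. b < 4 \<Longrightarrow> 2 dvd n b - n' b"
  shows "u \<in> L"
proof -
  have "has_coords (u + - g) (\<lambda>b l. y b l + - y' b l) (\<lambda>b. n b + - n' b)"
    by (intro has_coords_add has_coords_uminus u g)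
  then have "has_coords (u - g) (\<lambda>b l. 6 * ((y b l - y' b l) div 6)) (\<lambda>b. 2 * ((n b - n' b) div 2))"
    using y n u g(2) by (auto simp: has_coords_def)
  moreover have "(\<Sum>l<6. (y b l - y' b l) div 6) = 0" if "b < 3" for b
  proof -
    have "6 * (\<Sum>l<6. (y b l - y' b l) div 6) = (\<Sum>l<6. y b l - y' b l)"
      unfolding sum_distrib_left by (intro sum.cong) (use y that in auto)
    then show ?thesis using sums that by (simp add: sum_subtractf)
  qed
  ultimately have "u - g \<in> Lambda" by (rule in_Lambda)
  then have "g \<otimes>\<^bsub>monoid_vec TYPE(real) 26\<^esub> (u - g) \<in> L"
    unfolding L_def using g(1) by (intro generate.eng generate.incl) auto
  moreover have "g + (u - g) = u"
    using u g(2) by (intro eq_vecI) (auto simp: has_coords_def)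
  ultimately show ?thesis by (simp add: monoid_vec_simps)
qed

section \<open>The maximum\<close>

lemma form_sym: "form c c' = form c' c"
  by (simp add: form_def mult.commute)

lemma form_self: "c \<in> codes \<Longrightarrow> form c c = 90"
proof (cases "c \<in> triples")
  case True
  then show ?thesis using form_triples[OF True True] by simp
next
  case False
  assume "c \<in> codes"
  with False obtain b d s where c: "c = Signed b d s" "b < 3" "d \<in> {1, -1}" "s \<in> set half_signs"
    by (auto simp: codes_eq signeds_def)
  have "dot s s = (\<Sum>i<(6 :: nat). 1)"
    unfolding dot_half_signs[OF c(4,4)] by (intro sum.cong) (auto dest!: half_signs_nth[OF c(4)])
  then show ?thesis using c by (auto simp: form_signeds)
qed

text \<open>As \<open>s\<close> sums to zero, only the exceptional position of the triple in block
  \<open>b\<close> contributes, by -18 times a sign.\<close>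

lemma form_triple_signed:
  assumes "c \<in> triples" "b < 3" "s \<in> set half_signs"
  shows "form c (Signed b d s) \<in> {18, -18}"
proof -
  have t: "component b c < 6" using component_triples assms by blast
  have "form c (Signed b d s) = (\<Sum>b'<3. if b' = b then \<Sum>l<6. ycoord c b l * (3 * s ! l) else 0)"
    unfolding form_def using assms(1) by (intro sum.cong) (auto simp: ncoord_triples)
  also have "\<dots> = (\<Sum>l<6. ycoord c b l * (3 * s ! l))" using assms(2) by simp
  also have "\<dots> = (\<Sum>l<6. 3 * s ! l - (if l = component b c then 18 * s ! l else 0))"
    by (intro sum.cong) (auto simp: ycoord_triples[OF assms(1)])
  also have "\<dots> = - 18 * s ! component b c"
    using t sum_half_signs[OF assms(3)] by (simp add: sum_subtractf flip: sum_distrib_left)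
  finally show ?thesis using half_signs_nth[OF assms(3) t] by auto
qed

text \<open>The \<open>A_5\<close> parts lie in different blocks, and exactly one \<open>A_1\<close>
  component is nonzero for both.\<close>

lemma form_signed_signed:
  assumes "b < 3" "b' < 3" "b \<noteq> b'" "d \<in> {1, -1}" "d' \<in> {1, -1}"
  shows "form (Signed b d s) (Signed b' d' s') \<in> {18, -18}"
proof -
  have "form (Signed b d s) (Signed b' d' s')
      = (\<Sum>a<3. 18 * (ncoord (Signed b d s) a * ncoord (Signed b' d' s') a))"
    unfolding form_def using assms(3) by (intro sum.cong) (auto intro!: sum.neutral)
  then show ?thesis
    using less_3_cases[OF assms(1)] less_3_cases[OF assms(2)] assms(3-5)
    by (elim disjE insertE emptyE; simp add: sum_lessThan_3)
qed

text \<open>The positive supports are the blocks of a Pasch configuration, followed by three blocks of another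
  one that meet each of the former in one or two points.\<close>

definition seven_signs :: "(int \<times> int list) list" where
  "seven_signs =
    [(1, [1, 1, 1, -1, -1, -1]), (1, [1, -1, -1, -1, 1, 1]), (1, [-1, 1, -1, 1, -1, 1]),
     (1, [-1, -1, 1, 1, 1, -1]), (-1, [1, 1, -1, 1, -1, -1]), (-1, [-1, 1, 1, -1, 1, -1]),
     (-1, [1, -1, 1, -1, -1, 1])]"

text \<open>The Latin square is the addition table of the integers modulo 6; each block receives the
  same seven signed codes.\<close>

definition cyclic_codes :: "code set" where
  "cyclic_codes = (\<lambda>(i, j). Triple i j ((i + j) mod 6)) ` ({..<6} \<times> {..<6})
    \<union> (\<lambda>(b, d, s). Signed b d s) ` ({..<3} \<times> set seven_signs)"

lemma seven_signs_half_signs: "(d, s) \<in> set seven_signs \<Longrightarrow> d \<in> {1, -1} \<and> s \<in> set half_signs"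
  by (auto simp: seven_signs_def set_half_signs)

lemma seven_signs_dot:
  "\<forall>(d, s) \<in> set seven_signs. \<forall>(d', t) \<in> set seven_signs.
    (d, s) = (d', t) \<or> 9 * dot s t + 18 * (1 + d * d') \<in> {18, -18}"
  by code_simp

section \<open>A set of 57 vectors in \<open>L\<close>\<close>

lemma cyclic_codes_cases:
  assumes "c \<in> cyclic_codes"
  obtains i j where "i < 6" "j < 6" "c = Triple i j ((i + j) mod 6)"
    | b d s where "b < 3" "(d, s) \<in> set seven_signs" "c = Signed b d s"
  using assms by (auto simp: cyclic_codes_def)

lemma add_mod_6_cancel:
  fixes a b k :: nat
  assumes "(k + a) mod 6 = (k + b) mod 6" "a < 6" "b < 6"
  shows "a = b"
  using assms by presburger

lemma equiangular_cyclic_codes: "equiangular_codes cyclic_codes"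
proof -
  have sub: "c \<in> codes" if "c \<in> cyclic_codes" for c
    using that
  proof (cases rule: cyclic_codes_cases)
    case (1 i j)
    then show ?thesis by (auto simp: codes_def)
  next
    case (2 b d s)
    then show ?thesis using seven_signs_half_signs[OF 2(2)] by (auto simp: codes_def)
  qed
  have "form c c' \<in> {18, -18}" if c: "c \<in> cyclic_codes" and c': "c' \<in> cyclic_codes" and "c \<noteq> c'" for c c'
    using c
  proof (cases rule: cyclic_codes_cases)
    case (1 i j)
    then have tri: "c \<in> triples" by (auto simp: triples_def)
    from c' show ?thesis
    proof (cases rule: cyclic_codes_cases)
      case (1 i' j')
      then have tri': "c' \<in> triples" by (auto simp: triples_def)
      have "\<not> (i = i' \<and> j = j')" using \<open>c \<noteq> c'\<close> \<open>c = _\<close> 1 by auto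
      \<comment> \<open>By cancellation, triples that agree in one of the first two components
        differ in the third.\<close>
      moreover have "(i + j) mod 6 \<noteq> (i' + j') mod 6" if "i = i' \<or> j = j'" "\<not> (i = i' \<and> j = j')"
        using that add_mod_6_cancel[of i j j'] add_mod_6_cancel[of j i i'] \<open>i < 6\<close> \<open>j < 6\<close> 1(1,2)
        by (auto simp: add.commute)
      moreover have "form c c' = (if i = i' then 36 else 0) + (if j = j' then 36 else 0)
          + (if (i + j) mod 6 = (i' + j') mod 6 then 36 else 0) - 18"
        using form_triples[OF tri tri'] \<open>c = _\<close> 1(3) by (simp add: sum_lessThan_3)
      ultimately show ?thesis by (cases "i = i'"; cases "j = j'") auto
    next
      case (2 b d s)
      then show ?thesis using form_triple_signed[OF tri 2(1)] seven_signs_half_signs[OF 2(2)] by blast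
    qed
  next
    case (2 b d s)
    note ds = seven_signs_half_signs[OF 2(2)]
    from c' show ?thesis
    proof (cases rule: cyclic_codes_cases)
      case (1 i' j')
      then have "c' \<in> triples" by (auto simp: triples_def)
      then have "form c' c \<in> {18, -18}" using form_triple_signed[of c' b s d] 2 ds by simp
      then show ?thesis unfolding form_sym[of c c'] .
    next
      case (2 b' d' s')
      note ds' = seven_signs_half_signs[OF 2(2)]
      show ?thesis
      proof (cases "b = b'")
        case True
        then have "(d, s) \<noteq> (d', s')" using \<open>c \<noteq> c'\<close> \<open>c = _\<close> 2 by auto
        then have "9 * dot s s' + 18 * (1 + d * d') \<in> {18, -18}"
          using seven_signs_dot \<open>(d, s) \<in> _\<close> 2(2) by fast
        then show ?thesis using ds ds' True 2 \<open>c = _\<close> by (simp add: form_signeds)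
      next
        case False
        then show ?thesis
          using form_signed_signed[OF \<open>b < 3\<close> 2(1) False] ds ds' \<open>c = _\<close> 2(3) by blast
      qed
    qed
  qed
  with sub show ?thesis by (auto simp: equiangular_codes_def)
qed

lemma card_cyclic_codes: "card cyclic_codes = 57" "finite cyclic_codes"
proof -
  have "distinct seven_signs" by (simp add: seven_signs_def)
  then have "card (set seven_signs) = 7" by (simp add: distinct_card) (simp add: seven_signs_def)
  moreover have "inj_on (\<lambda>(b, d, s). Signed b d s) X" for X by (auto simp: inj_on_def)
  ultimately show "card cyclic_codes = 57"
    unfolding cyclic_codes_def
    by (subst card_Un_disjoint) (auto simp: card_image inj_on_def card_cartesian_product)
  show "finite cyclic_codes" by (simp add: cyclic_codes_def)
qed

text \<open>The candidate itself, with the positive sign, plus \<rho>/2 in the last block.\<close>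

definition code_vec :: "code \<Rightarrow> real vec" where
  "code_vec c = vec 26 (\<lambda>i. if i < 18 then ycoord c (i div 6) (i mod 6) / 6
    else (if i < 24 then ncoord c ((i - 18) div 2) else 1) * (if even i then 1 / 2 else - (1 / 2)))"

lemma has_coords_code_vec:
  "has_coords (code_vec c) (ycoord c) (\<lambda>b. if b = 3 then 1 else ncoord c b)"
proof -
  have "code_vec c $ (6 * b + l) = ycoord c b l / 6" if "b < 3" "l < 6" for b l
  proof -
    have "6 * b + l < 18" "(6 * b + l) div 6 = b" "(6 * b + l) mod 6 = l" using that by auto
    then show ?thesis unfolding code_vec_def by simp
  qed
  moreover have "code_vec c $ (18 + 2 * b) = (if b = 3 then 1 else ncoord c b) / 2"
    "code_vec c $ (19 + 2 * b) = - ((if b = 3 then 1 else ncoord c b) / 2)" if "b < 4" for b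
    using less_4_cases[OF that] by (auto simp: code_vec_def)
  ultimately show ?thesis by (simp add: has_coords_def code_vec_def)
qed

text \<open>The glue vector is \<open>beta0\<close> for a triple, as -5 and 1 are congruent modulo
  6, and \<open>beta1\<close>, \<open>beta2\<close> or \<open>beta3\<close> for a signed code, as 3,
  -3 and -15 are.\<close>

lemma code_vec_in_L:
  assumes "c \<in> codes"
  shows "code_vec c \<in> L"
proof (cases "c \<in> triples")
  case True
  show ?thesis
  proof (rule in_L[OF _ has_coords_beta0 has_coords_code_vec])
    show "6 dvd ycoord c b l - (if l = 5 then -5 else 1)" for b l
      by (simp add: ycoord_triples[OF True])
    show "2 dvd (if b = 3 then 1 else ncoord c b) - (if b = 3 then 1 else 0)" for b :: nat
      by (simp add: ncoord_triples[OF True])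
  qed (use sum_ycoord[OF assms] in \<open>simp_all add: sum_lessThan_6\<close>)
next
  case False
  with assms obtain b d s where c: "c = Signed b d s" "b < 3" "d \<in> {1, -1}" "s \<in> set half_signs"
    by (auto simp: codes_eq signeds_def)
  obtain g where g: "g \<in> {beta0, beta1, beta2, beta3}" "has_coords g (beta_y b) (beta_n b)"
    using less_3_cases[OF c(2)] has_coords_betas by blast
  show ?thesis
  proof (rule in_L[OF g has_coords_code_vec])
    show "6 dvd ycoord c b' l - beta_y b b' l" if "l < 6" for b' l
      using half_signs_nth[OF c(4) that] by (auto simp: c(1) beta_y_def)
    show "(\<Sum>l<6. beta_y b b' l) = 0" for b' by (simp add: beta_y_def sum_lessThan_6)
    show "2 dvd (if b' = 3 then 1 else ncoord c b') - beta_n b b'" for b'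
      using c(2,3) by (auto simp: c(1) beta_n_def)
  qed (use sum_ycoord[OF assms] in simp_all)
qed

lemma exists_affine_equiangular_57:
  obtains \<omega> where "affine_equiangular rho \<omega>" "\<omega> \<subseteq> L" "finite \<omega>" "card \<omega> = 57"
proof
  let ?\<omega> = "code_vec ` cyclic_codes"
  have sub: "c \<in> codes" if "c \<in> cyclic_codes" for c
    using equiangular_cyclic_codes that by (auto simp: equiangular_codes_def)
  have carrier: "code_vec c \<in> carrier_vec 26" for c by (simp add: code_vec_def)
  have dim: "dim_vec rho = 26" using has_coords_rho by (simp add: has_coords_def)
  have rho: "code_vec c \<bullet> rho = 1" for c
    using scalar_prod_has_coords[OF has_coords_code_vec[of c] has_coords_rho] by (simp add: sum_lessThan_4)
  have prod: "code_vec c \<bullet> code_vec c' = 1 / 2 + form c c' / 36" for c c'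
    using scalar_prod_codes[of "code_vec c" 1 c "code_vec c'" 1 c', unfolded mult_1,
        OF has_coords_code_vec has_coords_code_vec] .
  have norm: "code_vec c \<bullet> code_vec c = 3" if "c \<in> cyclic_codes" for c
    using form_self[OF sub[OF that]] by (simp add: prod)
  have pair: "code_vec c \<bullet> code_vec c' \<in> {0, 1}" if "c \<in> cyclic_codes" "c' \<in> cyclic_codes" "c \<noteq> c'" for c c'
  proof -
    have "form c c' = 18 \<or> form c c' = -18"
      using equiangular_cyclic_codes that by (auto simp: equiangular_codes_def)
    then show ?thesis by (auto simp: prod)
  qed
  show "affine_equiangular rho ?\<omega>"
    unfolding affine_equiangular_def dim using carrier rho norm pair by blast
  show "?\<omega> \<subseteq> L" using code_vec_in_L sub by blast
  show "finite ?\<omega>" using card_cyclic_codes(2) by simp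
  \<comment> \<open>Equal images of distinct codes would have inner product 3, which is neither 0
    nor 1.\<close>
  have "inj_on code_vec cyclic_codes"
    by (rule inj_onI) (use norm pair in force)
  then show "card ?\<omega> = 57" using card_cyclic_codes(1) by (simp add: card_image)
qed

section \<open>The spectrum of a maximum set\<close>

theorem corollary6p3:
  fixes \<omega> :: "real vec set" and us :: "real vec list"
  assumes "maximum_affine_equiangular_in L rho \<omega>"
    and "set us = \<omega>" and "distinct us"
  shows "char_poly (seidel_matrix rho us) =
           [:5, 1:] ^ 39 * [:-13, 1:] ^ 8 * [:-9, 1:] ^ 8 * [:72, -19, 1:]
       \<or> char_poly (seidel_matrix rho us) =
           [:5, 1:] ^ 39 * [:-13, 1:] ^ 6 * [:-9, 1:] ^ 6 * [:-11, 1:] * [:-12, 1:]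
             * [:87, -20, 1:] ^ 2"
proof -
  have equi: "affine_equiangular rho \<omega>" and sub: "\<omega> \<subseteq> L"
    and max: "\<not> (\<exists>\<omega>'. affine_equiangular rho \<omega>' \<and> \<omega>' \<subseteq> L \<and> \<omega> \<prec> \<omega>')"
    using assms(1) by (simp_all add: maximum_affine_equiangular_in_def)
  have fin: "finite \<omega>" using assms(2) by auto
  have card: "card \<omega> \<ge> 57"
  proof (rule exists_affine_equiangular_57)
    fix \<omega>' :: "real vec set"
    assume \<omega>': "affine_equiangular rho \<omega>'" "\<omega>' \<subseteq> L" "finite \<omega>'" "card \<omega>' = 57"
    then have "\<not> \<omega> \<prec> \<omega>'" using max by blast
    then show ?thesis using \<omega>'(3,4) fin by (auto simp: lesspoll_def lepoll_iff_card_le eqpoll_iff_card)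
  qed
  have dim_rho: "dim_vec rho = 26" and carrier_rho: "rho \<in> carrier_vec 26"
    using has_coords_rho by (auto simp: has_coords_def)
  \<comment> \<open>Each vector of \<open>\<omega>\<close> is assigned a sign \<open>e\<close> and a
    code \<open>c\<close>.\<close>
  define R where "R u e x \<longleftrightarrow> e \<in> {1, -1} \<and> x \<in> codes \<and>
      has_coords u (\<lambda>b l. e * ycoord x b l) (\<lambda>b. if b = 3 then 1 else e * ncoord x b)" for u e x
  have "\<exists>e x. R u e x" if "u \<in> \<omega>" for u
  proof -
    have "u \<in> L" "u \<bullet> rho = 1" "u \<bullet> u = 3"
      using equi sub that by (auto simp: affine_equiangular_def)
    then show ?thesis using L_code[of u] unfolding R_def by blast
  qed
  then obtain e c where f: "\<And>u. u \<in> \<omega> \<Longrightarrow> R u (e u) (c u)" by metis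
  have e: "e u = 1 \<or> e u = -1" and c: "c u \<in> codes"
    and coords: "has_coords u (\<lambda>b l. e u * ycoord (c u) b l) (\<lambda>b. if b = 3 then 1 else e u * ncoord (c u) b)"
    if "u \<in> \<omega>" for u
    using f[OF that] unfolding R_def by blast+
  have prod: "u \<bullet> v = 1 / 2 + of_int (e u * e v * form (c u) (c v)) / 36" if "u \<in> \<omega>" "v \<in> \<omega>" for u v
    by (rule scalar_prod_codes[OF coords[OF that(1)] coords[OF that(2)]])
  have form: "form (c u) (c v) \<in> {18, -18}" if "u \<in> \<omega>" "v \<in> \<omega>" "u \<noteq> v" for u v
  proof -
    have "u \<bullet> v = 0 \<or> u \<bullet> v = 1" using equi that by (auto simp: affine_equiangular_def)
    moreover have "real_of_int (e u * e v * form (c u) (c v)) = 36 * (u \<bullet> v) - 18"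
      unfolding prod[OF that(1,2)] by (simp del: of_int_mult)
    ultimately have "real_of_int (e u * e v * form (c u) (c v)) = real_of_int 18
        \<or> real_of_int (e u * e v * form (c u) (c v)) = real_of_int (-18)"
      by (elim disjE) (simp_all del: of_int_mult)
    then have "e u * e v * form (c u) (c v) \<in> {18, -18}" unfolding of_int_eq_iff by simp
    then show ?thesis using e[OF that(1)] e[OF that(2)] by auto
  qed
  have inj: "inj_on c \<omega>"
  proof (rule inj_onI, rule ccontr)
    fix u v assume uv: "u \<in> \<omega>" "v \<in> \<omega>" "c u = c v" "u \<noteq> v"
    then show False using form[OF uv(1,2,4)] form_self[OF c[OF uv(1)]] by simp
  qed
  have "equiangular_codes (c ` \<omega>)"
    unfolding equiangular_codes_def using c form by blast
  moreover have "card (c ` \<omega>) \<ge> 57" using card inj by (simp add: card_image)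
  ultimately show ?thesis
  proof (rule frame_operator)
    fix d hs
    assume card57: "card (c ` \<omega>) = 57" and d: "\<And>b. b < 3 \<Longrightarrow> d b \<in> {1, -1}"
      and hs: "\<And>b. b < 3 \<Longrightarrow> sort (hs b) = [0..<6]"
      and frame: "\<And>i j. i < 18 \<Longrightarrow> j < 18 \<Longrightarrow>
        weight i * (\<Sum>x\<in>c ` \<omega>. frame_coord hs x i * frame_coord hs x j) = frame_entry d i j"
    have len: "length us = 57"
      using card57 inj distinct_card[OF assms(3)] assms(2) by (simp add: card_image)
    have us: "us ! k \<in> \<omega>" if "k < 57" for k using that assms(2) len by auto
    \<comment> \<open>\<open>X * Z\<close> is the Gram matrix of the scaled vectors in frame
      coordinates. The signs enter both factors, the weights only \<open>Z\<close>.\<close>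
    define X where "X = mat 57 18 (\<lambda>(k, a). real_of_int (e (us ! k) * frame_coord hs (c (us ! k)) a))"
    define Z where "Z = mat 18 57 (\<lambda>(a, k). weight a * real_of_int (e (us ! k) * frame_coord hs (c (us ! k)) a))"
    have X: "X \<in> carrier_mat 57 18" and Z: "Z \<in> carrier_mat 18 57" by (simp_all add: X_def Z_def)
    have "seidel_matrix rho us = X * Z - 5 \<cdot>\<^sub>m 1\<^sub>m 57"
    proof (rule eq_matI)
      fix k l assume "k < dim_row (X * Z - 5 \<cdot>\<^sub>m 1\<^sub>m 57)" "l < dim_col (X * Z - 5 \<cdot>\<^sub>m 1\<^sub>m 57)"
      then have kl: "k < 57" "l < 57" by auto
      define u where "u = us ! k"
      define v where "v = us ! l"
      have uv: "u \<in> \<omega>" "v \<in> \<omega>" using us kl by (auto simp: u_def v_def)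
      have carrier: "u \<in> carrier_vec 26" "v \<in> carrier_vec 26"
        using coords uv by (auto simp: has_coords_def)
      have rho: "u \<bullet> rho = 1" "v \<bullet> rho = 1" using equi uv by (auto simp: affine_equiangular_def)
      have rho_rho: "rho \<bullet> rho = 2"
        using scalar_prod_has_coords[OF has_coords_rho has_coords_rho]
        by (simp add: eval_nat_numeral)
      have "tilde rho u \<bullet> tilde rho v = (1 / sqrt 2) * ((1 / sqrt 2) * ((2 \<cdot>\<^sub>v u - rho) \<bullet> (2 \<cdot>\<^sub>v v - rho)))"
        unfolding tilde_def using carrier carrier_rho by simp
      also have "\<dots> = ((2 \<cdot>\<^sub>v u - rho) \<bullet> (2 \<cdot>\<^sub>v v - rho)) / 2" by (simp add: field_simps)
      also have "(2 \<cdot>\<^sub>v u - rho) \<bullet> (2 \<cdot>\<^sub>v v - rho)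
          = 4 * (u \<bullet> v) - 2 * (u \<bullet> rho) - 2 * (v \<bullet> rho) + rho \<bullet> rho"
        using carrier carrier_rho
        by (simp add: minus_scalar_prod_distrib[of _ 26] scalar_prod_minus_distrib[of _ 26]
            comm_scalar_prod[of rho 26 v])
      also have "\<dots> / 2 = 2 * (u \<bullet> v) - 1" using rho rho_rho by simp
      also have "\<dots> = e u * e v * (form (c u) (c v) / 18)"
        unfolding prod[OF uv] by (simp add: field_simps)
      also have "real_of_int (form (c u) (c v)) / 18
          = (\<Sum>a<18. weight a * frame_coord hs (c u) a * frame_coord hs (c v) a)"
        by (rule form_eq_frame_coord[OF c[OF uv(1)]]) (rule hs)
      also have "e u * e v * \<dots> = (\<Sum>a<18. X $$ (k, a) * Z $$ (a, l))"
        unfolding sum_distrib_left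
        using kl by (intro sum.cong) (auto simp: X_def Z_def u_def v_def)
      also have "\<dots> = (X * Z) $$ (k, l)"
        using kl X Z by (simp add: scalar_prod_def atLeast0LessThan)
      finally have "tilde rho u \<bullet> tilde rho v = (X * Z) $$ (k, l)" .
      moreover have "tilde rho w \<in> carrier_vec 26" for w
        by (intro carrier_vecI) (simp add: tilde_def dim_rho)
      ultimately show "seidel_matrix rho us $$ (k, l) = (X * Z - 5 \<cdot>\<^sub>m 1\<^sub>m 57) $$ (k, l)"
        using kl len dim_rho by (simp add: seidel_matrix_def Let_def X_def Z_def u_def v_def)
    qed (simp_all add: seidel_matrix_def Let_def len X_def Z_def)
    moreover have "Z * X = mat 18 18 (\<lambda>(i, j). frame_entry d i j)"
    proof (rule eq_matI)
      fix i j assume "i < dim_row (mat 18 18 (\<lambda>(i, j). frame_entry d i j))"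
        "j < dim_col (mat 18 18 (\<lambda>(i, j). frame_entry d i j))"
      then have ij: "i < 18" "j < 18" by auto
      define g where "g x = frame_coord hs x i * frame_coord hs x j" for x
      have "(Z * X) $$ (i, j) = (\<Sum>k<57. Z $$ (i, k) * X $$ (k, j))"
        using ij X Z by (simp add: scalar_prod_def atLeast0LessThan)
      \<comment> \<open>The signs cancel because \<open>e\<close> squares to 1, so
        \<open>Z * X\<close> depends on the codes alone.\<close>
      also have "\<dots> = (\<Sum>k<57. weight i * of_int (g (c (us ! k))))"
      proof (intro sum.cong refl)
        fix k assume "k \<in> {..<57 :: nat}"
        then show "Z $$ (i, k) * X $$ (k, j) = weight i * of_int (g (c (us ! k)))"
          using ij e[OF us[of k]] by (auto simp: X_def Z_def g_def)
      qed
      also have "\<dots> = (\<Sum>u\<in>\<omega>. weight i * of_int (g (c u)))"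
        using sum.reindex_bij_betw[OF bij_betw_nth[OF assms(3) _ assms(2)[symmetric]], of "{..<57}"] len
        by simp
      also have "\<dots> = weight i * of_int (\<Sum>x\<in>c ` \<omega>. g x)"
        by (simp add: sum.reindex[OF inj] sum_distrib_left)
      also have "\<dots> = frame_entry d i j" unfolding g_def by (rule frame[OF ij])
      finally show "(Z * X) $$ (i, j) = mat 18 18 (\<lambda>(i, j). frame_entry d i j) $$ (i, j)"
        using ij by simp
    qed (simp_all add: X_def Z_def)
    ultimately show ?thesis
      using char_poly_of_frame[OF X Z, of d] d by simp
  qed
qed

end
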